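(* Let $S\subset\mathbb{P}^3$ be an irreducible and reduced quartic surface over $\mathbb{C}$ whose minimal Cremona degree is different from $4$. Then $S$ has a non trivial stabilizer in the Cremona group $Cr_3$.
   Context: Work over $\mathbb{C}$. $Cr_n$ denotes the Cremona group, i.e. the group of birational self-maps of $\mathbb{P}^n$. Two irreducible and reduced birational subvarieties $X,Y\subset\mathbb{P}^n$ are called Cremona Equivalent if there is a birational map $\varphi:\mathbb{P}^n\dashrightarrow\mathbb{P}^n$ which is an isomorphism at the generic point of $X$ and satisfies $\varphi(X)=Y$. For an irreducible and reduced hypersurface $X\subset\mathbb{P}^n$, the minimal Cremona degree of $X$ is $\min\{d : X \text{ is Cremona Equivalent to a hypersurface of degree } d\}$. A hypersurface $X\subset\mathbb{P}^n$ is said to have a non trivial stabilizer in $Cr_n$ if there is a birational map $\omega:\mathbb{P}^n\dashrightarrow\mathbb{P}^n$ that is not an isomorphism, is an isomorphism at the generic point of $X$, and satisfies $\omega(X)=X$. *)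

theory Defs
  imports
    "HOL-Analysis.Analysis"
    "HOL-Library.Poly_Mapping"
    "HOL-Library.Numeral_Type"
    "HOL-Computational_Algebra.Factorial_Ring"
begin

section \<open>Forms in several variables\<close>

text \<open>Polynomials over the complex numbers in variables indexed by \<open>'n\<close>: coefficients are indexed
  by exponent vectors, and the ring structure is the convolution product of \<open>Poly_Mapping\<close>.\<close>

type_synonym 'n cpoly = "('n \<Rightarrow>\<^sub>0 nat) \<Rightarrow>\<^sub>0 complex"

definition poly_value :: "'n::finite cpoly \<Rightarrow> complex ^ 'n \<Rightarrow> complex" where
  "poly_value F v =
     (\<Sum>m\<in>Poly_Mapping.keys F. Poly_Mapping.lookup F m * (\<Prod>i\<in>UNIV. (v $ i) ^ Poly_Mapping.lookup m i))"

definition homogeneous :: "nat \<Rightarrow> 'n::finite cpoly \<Rightarrow> bool" where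
  "homogeneous d F \<longleftrightarrow>
     (\<forall>m\<in>Poly_Mapping.keys F. (\<Sum>i\<in>UNIV. Poly_Mapping.lookup m i) = d)"


section \<open>Projective space and its Zariski topology\<close>

definition proportional :: "complex ^ 'n::finite \<Rightarrow> complex ^ 'n \<Rightarrow> bool" where
  "proportional v w \<longleftrightarrow> v \<noteq> 0 \<and> w \<noteq> 0 \<and> (\<exists>c. c \<noteq> 0 \<and> w = c *s v)"

text \<open>The type \<open>'n proj\<close> is the projective space of dimension \<open>CARD('n) - 1\<close>, so that \<open>4 proj\<close> is
  projective 3-space. Only nonzero vectors are homogeneous coordinates; \<open>point 0\<close> is meaningless.\<close>

quotient_type 'n proj = "complex ^ 'n::finite" / partial: proportional
  morphisms rep_proj point
proof (rule part_equivpI)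
  show "\<exists>x :: complex ^ 'n. proportional x x"
    by (rule exI[of _ 1]) (auto simp: proportional_def intro!: exI[of _ 1])
  show "symp (proportional :: complex ^ 'n \<Rightarrow> _)"
  proof (rule sympI)
    fix x y :: "complex ^ 'n"
    assume "proportional x y"
    then obtain c where "x \<noteq> 0" "y \<noteq> 0" "c \<noteq> 0" "y = c *s x"
      by (auto simp: proportional_def)
    then show "proportional y x"
      unfolding proportional_def by (auto intro!: exI[of _ "inverse c"])
  qed
  show "transp (proportional :: complex ^ 'n \<Rightarrow> _)"
  proof (rule transpI)
    fix x y z :: "complex ^ 'n"
    assume "proportional x y" and "proportional y z"
    then obtain c d where "x \<noteq> 0" "z \<noteq> 0" "c \<noteq> 0" "d \<noteq> 0" "z = d *s (c *s x)"
      by (auto simp: proportional_def)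
    then show "proportional x z"
      unfolding proportional_def by (auto intro!: exI[of _ "d * c"])
  qed
qed

definition zeros :: "'n::finite cpoly \<Rightarrow> 'n proj set" where
  "zeros F = point ` {v. v \<noteq> 0 \<and> poly_value F v = 0}"

text \<open>The generators are the principal open sets \<open>F \<noteq> 0\<close>. They are closed under finite
  intersection, so their unions are precisely the complements of the algebraic sets.\<close>

definition zariski :: "'n::finite proj topology" where
  "zariski = topology_generated_by {- zeros F | F. \<exists>d. homogeneous d F}"

text \<open>The irreducible and reduced hypersurfaces of degree \<open>d\<close>. Being reduced, they are determined by
  their sets of points.\<close>

definition irreducible_hypersurface :: "nat \<Rightarrow> 'n::finite proj set \<Rightarrow> bool" where
  "irreducible_hypersurface d X \<longleftrightarrow> (\<exists>F. homogeneous d F \<and> irreducible F \<and> X = zeros F)"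


section \<open>Rational maps and birational maps\<close>

definition tuple_value :: "('n::finite \<Rightarrow> 'n cpoly) \<Rightarrow> complex ^ 'n \<Rightarrow> complex ^ 'n" where
  "tuple_value G v = (\<chi> i. poly_value (G i) v)"

text \<open>Morphisms to projective space from a nonempty open subset, which is recorded as the domain of
  the partial function: locally they are given by forms of the same degree without common zero.\<close>

definition partial_morphism :: "('n::finite proj \<rightharpoonup> 'n proj) \<Rightarrow> bool" where
  "partial_morphism f \<longleftrightarrow>
     openin zariski (dom f) \<and> dom f \<noteq> {} \<and>
     (\<forall>p\<in>dom f. \<exists>U G d. openin zariski U \<and> p \<in> U \<and> U \<subseteq> dom f \<and> (\<forall>i. homogeneous d (G i)) \<and>
        (\<forall>v. v \<noteq> 0 \<and> point v \<in> U \<longrightarrow>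
           tuple_value G v \<noteq> 0 \<and> f (point v) = Some (point (tuple_value G v))))"

text \<open>A rational map is an equivalence class of such morphisms, two of them being equivalent if they
  agree where both are defined. Each class is represented by its unique member with the largest
  domain, so the domain of a rational map is its domain of definition and equality of rational maps
  is equality of partial functions.\<close>

definition rational_map :: "('n::finite proj \<rightharpoonup> 'n proj) \<Rightarrow> bool" where
  "rational_map f \<longleftrightarrow>
     partial_morphism f \<and> (\<forall>g. partial_morphism g \<and> f \<subseteq>\<^sub>m g \<longrightarrow> g = f)"

text \<open>The composite of \<open>f\<close> and then \<open>g\<close> exists as a rational map, and is the identity there.\<close>

definition composes_to_identity ::
    "('n::finite proj \<rightharpoonup> 'n proj) \<Rightarrow> ('n proj \<rightharpoonup> 'n proj) \<Rightarrow> bool" where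
  "composes_to_identity g f \<longleftrightarrow> dom (g \<circ>\<^sub>m f) \<noteq> {} \<and> g \<circ>\<^sub>m f \<subseteq>\<^sub>m Some"

definition birational :: "('n::finite proj \<rightharpoonup> 'n proj) \<Rightarrow> bool" where
  "birational f \<longleftrightarrow> rational_map f \<and>
     (\<exists>g. rational_map g \<and> composes_to_identity g f \<and> composes_to_identity f g)"

text \<open>Mutually inverse isomorphisms between the open sets \<open>dom f\<close> and \<open>dom g\<close>.\<close>

definition inverse_isomorphisms ::
    "('n::finite proj \<rightharpoonup> 'n proj) \<Rightarrow> ('n proj \<rightharpoonup> 'n proj) \<Rightarrow> bool" where
  "inverse_isomorphisms f g \<longleftrightarrow>
     partial_morphism f \<and> partial_morphism g \<and> (\<forall>p q. f p = Some q \<longleftrightarrow> g q = Some p)"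

definition isomorphism :: "('n::finite proj \<rightharpoonup> 'n proj) \<Rightarrow> bool" where
  "isomorphism f \<longleftrightarrow>
     dom f = UNIV \<and> (\<exists>g. dom g = UNIV \<and> inverse_isomorphisms f g)"

text \<open>For irreducible \<open>X\<close>, the open sets containing the generic point of \<open>X\<close> are those that meet
  \<open>X\<close>.\<close>

definition isomorphism_at_generic_point :: "('n::finite proj \<rightharpoonup> 'n proj) \<Rightarrow> 'n proj set \<Rightarrow> bool" where
  "isomorphism_at_generic_point f X \<longleftrightarrow>
     (\<exists>U g. openin zariski U \<and> U \<subseteq> dom f \<and> U \<inter> X \<noteq> {} \<and> inverse_isomorphisms (f |` U) g)"

text \<open>The image of a subvariety under a rational map is the closure of the image of the part on which
  the map is defined.\<close>

definition proper_image :: "('n::finite proj \<rightharpoonup> 'n proj) \<Rightarrow> 'n proj set \<Rightarrow> 'n proj set" where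
  "proper_image f X = zariski closure_of {q. \<exists>p\<in>X. f p = Some q}"


section \<open>Cremona equivalence\<close>

definition cremona_equivalent :: "'n::finite proj set \<Rightarrow> 'n proj set \<Rightarrow> bool" where
  "cremona_equivalent X Y \<longleftrightarrow>
     (\<exists>f. birational f \<and> isomorphism_at_generic_point f X \<and> proper_image f X = Y)"

definition min_cremona_degree :: "'n::finite proj set \<Rightarrow> nat" where
  "min_cremona_degree X =
     (LEAST d. \<exists>Y. irreducible_hypersurface d Y \<and> cremona_equivalent X Y)"

definition nontrivial_stabilizer :: "'n::finite proj set \<Rightarrow> bool" where
  "nontrivial_stabilizer X \<longleftrightarrow>
     (\<exists>w. birational w \<and> \<not> isomorphism w \<and> isomorphism_at_generic_point w X \<and> proper_image w X = X)"

end

theory Submission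
  imports
    Defs
    "HOL-Computational_Algebra.Polynomial_Factorial"
    "HOL-Computational_Algebra.Fundamental_Theorem_Algebra"
    "HOL-Computational_Algebra.Field_as_Ring"
begin

text \<open>Let \<open>S\<close> be equivalent to a surface \<open>T\<close> of degree at most 3 by \<open>\<phi>\<close>. Projecting from a suitable point
  \<open>p\<close> of \<open>T\<close>, a general line through \<open>p\<close> meets \<open>T\<close> in at most two further points. Moebius
  transformations of these lines that fix those points glue to a nontrivial birational map \<open>\<omega>\<close> that fixes \<open>T\<close> pointwise
  and is a local isomorphism at a prescribed point of \<open>T\<close>. Then \<open>\<phi>\<inverse> \<omega> \<phi>\<close> is not the identity and fixes \<open>S\<close>
  pointwise. It is not an automorphism: those are linear, \<open>x \<mapsto> A x\<close>, and the quadratic forms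
  \<open>(A x)\<^sub>i x\<^sub>j - (A x)\<^sub>j x\<^sub>i\<close> would vanish on the irreducible quartic \<open>S\<close>, so that they
  would be zero and \<open>A x\<close> proportional to \<open>x\<close>.\<close>

section \<open>Evaluation homomorphisms\<close>

text \<open>\<open>S\<close> is equivalent to itself, so its minimal degree is at most 4, and the
  hypothesis leaves at most 3. On a line through a smooth point of a quartic there are in general
  three residual points, and a Moebius map fixing three points is the identity; this is why the
  construction takes place on \<open>T\<close>. The Moebius maps that fix the zeros of C + B z + A
  z^2 have the matrices \<open>\<alpha>\<close> I + (0, -C; A, B). The free parameter
  \<open>\<alpha>\<close> is what allows regularity at a chosen point. This freedom is needed
  because \<open>\<phi>\<close> is an isomorphism only near some point of \<open>S\<close>: the map
  of \<open>T\<close> must be a local isomorphism at the image of that point for the conjugate to be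
  one at the generic point of \<open>S\<close>. Two algebraic facts carry the rest: a polynomial
  vanishing on an irreducible hypersurface is divisible by its equation, and a tuple of forms can be
  freed of its common factor. Both rest on unique factorization.\<close>

locale ring_homomorphism =
  fixes f :: "'a::comm_ring_1 \<Rightarrow> 'b::comm_ring_1"
  assumes hom_one: "f 1 = 1"
    and hom_add: "f (a + b) = f a + f b"
    and hom_mult: "f (a * b) = f a * f b"
begin

lemma hom_zero: "f 0 = 0"
  using hom_add[of 0 0] by simp

lemma hom_uminus: "f (- a) = - f a"
  using hom_add[of a "- a"] by (simp add: hom_zero eq_neg_iff_add_eq_0 add.commute)

lemma hom_diff: "f (a - b) = f a - f b"
  using hom_add[of a "- b"] by (simp add: hom_uminus)

lemma hom_prod: "f (\<Prod>i\<in>I. g i) = (\<Prod>i\<in>I. f (g i))"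
  by (induction I rule: infinite_finite_induct) (simp_all add: hom_one hom_mult)

lemma hom_power: "f (a ^ n) = f a ^ n"
  by (induction n) (simp_all add: hom_one hom_mult)

lemma hom_dvd: "a dvd b \<Longrightarrow> f a dvd f b"
  by (auto simp: dvd_def hom_mult)

end

lemma ring_homomorphism_id: "ring_homomorphism (\<lambda>x. x)"
  by unfold_locales simp_all

lemma ring_homomorphism_comp:
  "ring_homomorphism f \<Longrightarrow> ring_homomorphism g \<Longrightarrow> ring_homomorphism (\<lambda>x. g (f x))"
  unfolding ring_homomorphism_def by simp

lemma ring_homomorphism_const_poly: "ring_homomorphism (\<lambda>a. [:a:])"
  by unfold_locales (simp_all add: one_pCons)

lemma ring_homomorphism_poly: "ring_homomorphism (\<lambda>p. poly p c)"
  by unfold_locales simp_all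

section \<open>Extension of a ring homomorphism to univariate polynomials\<close>

definition poly_extension :: "('a::comm_ring_1 \<Rightarrow> 'b::comm_ring_1) \<Rightarrow> 'b \<Rightarrow> 'a poly \<Rightarrow> 'b" where
  "poly_extension f c p = poly (map_poly f p) c"

context ring_homomorphism begin

lemma poly_extension_pCons:
  "poly_extension f c (pCons a p) = f a + c * poly_extension f c p"
  by (simp add: poly_extension_def map_poly_pCons hom_zero)

lemma poly_extension_0: "poly_extension f c 0 = 0"
  by (simp add: poly_extension_def)

lemma poly_extension_const: "poly_extension f c [:a:] = f a"
  by (simp add: poly_extension_pCons poly_extension_0)

lemma poly_extension_var: "poly_extension f c [:0, 1:] = c"
  by (simp add: poly_extension_pCons poly_extension_0 hom_zero hom_one)

lemma poly_extension_add:
  "poly_extension f c (p + q) = poly_extension f c p + poly_extension f c q"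
  by (induction p q rule: poly_induct2)
    (simp_all add: poly_extension_0 poly_extension_pCons hom_add algebra_simps)

lemma poly_extension_smult: "poly_extension f c (smult a p) = f a * poly_extension f c p"
  by (induction p) (simp_all add: poly_extension_0 poly_extension_pCons hom_mult algebra_simps)

lemma poly_extension_mult:
  "poly_extension f c (p * q) = poly_extension f c p * poly_extension f c q"
  by (induction p)
    (simp_all add: poly_extension_0 poly_extension_pCons poly_extension_add poly_extension_smult
      hom_zero algebra_simps)

lemma poly_extension_hom: "ring_homomorphism (poly_extension f c)"
  by unfold_locales
    (simp_all add: one_pCons poly_extension_pCons poly_extension_0 hom_one poly_extension_add
      poly_extension_mult)

end

lemma poly_hom_eq_extension:
  assumes "ring_homomorphism k"
  shows "k p = poly_extension (\<lambda>a. k [:a:]) (k [:0, 1:]) p"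
proof -
  interpret k: ring_homomorphism k by fact
  interpret c: ring_homomorphism "\<lambda>a. k [:a:]"
    by (rule ring_homomorphism_comp[OF ring_homomorphism_const_poly assms])
  show ?thesis
  proof (induction p)
    case 0
    show ?case by (simp add: k.hom_zero poly_extension_def)
  next
    case (pCons a p)
    have "k (pCons a p) = k ([:a:] + [:0, 1:] * p)"
      by simp
    then show ?case
      using pCons.IH by (simp add: c.poly_extension_pCons k.hom_add k.hom_mult del: mult_pCons_left)
  qed
qed

lemma poly_hom_eqI:
  assumes "ring_homomorphism k" "ring_homomorphism l"
    and "\<And>a. k [:a:] = l [:a:]" "k [:0, 1:] = l [:0, 1:]"
  shows "k p = l p"
  unfolding poly_hom_eq_extension[OF assms(1), of p] poly_hom_eq_extension[OF assms(2), of p]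
    assms(3,4) ..

section \<open>Substitution into polynomials in several variables\<close>

definition Const :: "complex \<Rightarrow> 'n::finite cpoly" where
  "Const c = Poly_Mapping.single 0 c"

definition Var :: "'n::finite \<Rightarrow> 'n cpoly" where
  "Var i = Poly_Mapping.single (Poly_Mapping.single i 1) 1"

lemma Const_hom: "ring_homomorphism (Const :: complex \<Rightarrow> 'n::finite cpoly)"
  by unfold_locales (simp_all add: Const_def single_add mult_single)

interpretation Const: ring_homomorphism "Const :: complex \<Rightarrow> 'n::finite cpoly"
  by (rule Const_hom)

lemma cpoly_induct [case_names single add]:
  assumes single: "\<And>m c. P (Poly_Mapping.single m c)"
    and add: "\<And>F G. P F \<Longrightarrow> P G \<Longrightarrow> P (F + G)"
  shows "P (F :: 'n::finite cpoly)"
proof (induction F rule: update_induct)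
  case const
  then show ?case using single[of 0 0] by simp
next
  case (update F m c)
  have "Poly_Mapping.update m c F = Poly_Mapping.single m c + F"
  proof (rule poly_mapping_eqI)
    fix k
    show "Poly_Mapping.lookup (Poly_Mapping.update m c F) k
      = Poly_Mapping.lookup (Poly_Mapping.single m c + F) k"
      using update(1) by (auto simp: lookup_update lookup_add lookup_single when_def in_keys_iff)
  qed
  then show ?case using add[OF single update(3)] by simp
qed

text \<open>The target ring is arbitrary and coefficients pass through \<open>h\<close>, so that one
  construction serves for evaluation, composition of forms, grading, restriction to a line and
  nesting of variables.\<close>

definition insertion :: "(complex \<Rightarrow> 'a::comm_ring_1) \<Rightarrow> ('n::finite \<Rightarrow> 'a) \<Rightarrow> 'n cpoly \<Rightarrow> 'a" where
  "insertion h x F = (\<Sum>m\<in>Poly_Mapping.keys F.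
     h (Poly_Mapping.lookup F m) * (\<Prod>i\<in>UNIV. x i ^ Poly_Mapping.lookup m i))"

lemma poly_value_eq_insertion: "poly_value F v = insertion (\<lambda>c. c) (\<lambda>i. v $ i) F"
  by (simp add: poly_value_def insertion_def)

text \<open>Cancellation may make the support of a sum smaller than the union of the supports; a
  common index set lets the sums be added term by term.\<close>

lemma insertion_superset:
  assumes "ring_homomorphism h" "finite K" "Poly_Mapping.keys F \<subseteq> K"
  shows "insertion h x F = (\<Sum>m\<in>K.
    h (Poly_Mapping.lookup F m) * (\<Prod>i\<in>UNIV. x i ^ Poly_Mapping.lookup m i))"
  unfolding insertion_def
  by (rule sum.mono_neutral_left)
    (use assms in \<open>auto simp: in_keys_iff ring_homomorphism.hom_zero\<close>)

lemma insertion_single: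
  assumes "ring_homomorphism h"
  shows "insertion h x (Poly_Mapping.single m c) = h c * (\<Prod>i\<in>UNIV. x i ^ Poly_Mapping.lookup m i)"
  using insertion_superset[OF assms, of "{m}" "Poly_Mapping.single m c" x] by simp

lemma insertion_add:
  assumes "ring_homomorphism h"
  shows "insertion h x (F + G) = insertion h x F + insertion h x G"
proof -
  interpret ring_homomorphism h by fact
  let ?K = "Poly_Mapping.keys F \<union> Poly_Mapping.keys G"
  have "Poly_Mapping.keys (F + G) \<subseteq> ?K"
    by (rule Poly_Mapping.keys_add)
  then show ?thesis
    by (simp add: insertion_superset[OF assms, of ?K] lookup_add hom_add distrib_right sum.distrib)
qed

lemma insertion_mult_single:
  assumes "ring_homomorphism h"
  shows "insertion h x (Poly_Mapping.single m c * G) =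
    insertion h x (Poly_Mapping.single m c) * insertion h x G"
proof -
  interpret ring_homomorphism h by fact
  show ?thesis
  proof (induction G rule: cpoly_induct)
    case (single m' c')
    then show ?case
      by (simp add: mult_single insertion_single[OF assms] hom_mult lookup_add power_add
          prod.distrib algebra_simps)
  next
    case (add F G)
    then show ?case by (simp add: distrib_left insertion_add[OF assms])
  qed
qed

lemma insertion_hom:
  assumes "ring_homomorphism h"
  shows "ring_homomorphism (insertion h x)"
proof
  interpret ring_homomorphism h by fact
  show "insertion h x 1 = 1"
    using insertion_single[OF assms, of x 0 1] by (simp add: hom_one)
  show "insertion h x (F + G) = insertion h x F + insertion h x G" for F G
    by (rule insertion_add[OF assms])
  show "insertion h x (F * G) = insertion h x F * insertion h x G" for F G
    by (induction F rule: cpoly_induct)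
      (simp_all add: insertion_mult_single[OF assms] distrib_right insertion_add[OF assms])
qed

lemma insertion_Const: "ring_homomorphism h \<Longrightarrow> insertion h x (Const c) = h c"
  unfolding Const_def by (subst insertion_single) auto

lemma insertion_Var: "ring_homomorphism h \<Longrightarrow> insertion h x (Var i) = x i"
  unfolding Var_def
  by (subst insertion_single)
    (auto simp: ring_homomorphism.hom_one lookup_single when_def if_distrib prod.If_cases
      cong: if_cong)

lemma Var_power: "Var i ^ n = Poly_Mapping.single (Poly_Mapping.single i n) 1"
  by (induction n) (simp_all add: Var_def mult_single single_add[symmetric])

lemma prod_single:
  "finite I \<Longrightarrow> (\<Prod>i\<in>I. Poly_Mapping.single (a i) 1) = Poly_Mapping.single (\<Sum>i\<in>I. a i) (1::complex)"
  by (induction I rule: finite_induct) (simp_all add: mult_single)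

lemma single_eq_monomial:
  "Poly_Mapping.single m c = Const c * (\<Prod>i\<in>UNIV. Var i ^ Poly_Mapping.lookup m i)"
proof -
  have "(\<Sum>i\<in>UNIV. Poly_Mapping.single i (Poly_Mapping.lookup m i)) = m"
    by (rule poly_mapping_eqI) (simp add: lookup_sum lookup_single when_def)
  then have "(\<Prod>i\<in>UNIV. Var i ^ Poly_Mapping.lookup m i) = Poly_Mapping.single m (1::complex)"
    by (simp add: Var_power prod_single)
  then show ?thesis by (simp add: Const_def mult_single)
qed

lemma cpoly_hom_eqI:
  assumes "ring_homomorphism k" "ring_homomorphism l"
    and "\<And>c. k (Const c) = l (Const c)" "\<And>i. k (Var i) = l (Var i)"
  shows "k F = l F"
proof -
  interpret k: ring_homomorphism k by fact
  interpret l: ring_homomorphism l by fact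
  show ?thesis
  proof (induction F rule: cpoly_induct)
    case (single m c)
    show ?case
      unfolding single_eq_monomial k.hom_mult l.hom_mult k.hom_prod l.hom_prod k.hom_power l.hom_power
        assms(3,4) ..
  next
    case (add F G)
    then show ?case by (simp only: k.hom_add l.hom_add)
  qed
qed

lemma poly_value_hom: "ring_homomorphism (\<lambda>F. poly_value F v)"
  using insertion_hom[OF ring_homomorphism_id] by (simp only: poly_value_eq_insertion)

interpretation poly_value: ring_homomorphism "\<lambda>F. poly_value F v"
  by (rule poly_value_hom)

lemma poly_value_Const [simp]: "poly_value (Const c) v = c"
  by (simp add: poly_value_eq_insertion insertion_Const ring_homomorphism_id)

lemma poly_value_Var [simp]: "poly_value (Var i) v = v $ i"
  by (simp add: poly_value_eq_insertion insertion_Var ring_homomorphism_id)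

section \<open>The Nullstellensatz for hypersurfaces\<close>

text \<open>A substitute for the resultant: an element of least degree in the ideal generated by
  \<open>f\<close> and \<open>h\<close> turns out to be a constant.\<close>

lemma prime_poly_eliminates:
  fixes f h :: "'a::idom poly"
  assumes f: "prime_elem f" "degree f > 0" and h: "\<not> f dvd h"
  shows "\<exists>a b r. r \<noteq> 0 \<and> [:r:] = a * f + b * h"
proof -
  define I where "I = {a * f + b * h | a b. True}"
  have I_add: "x + y \<in> I" if "x \<in> I" "y \<in> I" for x y
  proof -
    from that obtain a b c d where "x = a * f + b * h" "y = c * f + d * h"
      by (auto simp: I_def)
    then have "x + y = (a + c) * f + (b + d) * h" by (simp add: algebra_simps)
    then show ?thesis unfolding I_def by blast
  qed
  have I_mult: "c * x \<in> I" if "x \<in> I" for c x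
  proof -
    from that obtain a b where "x = a * f + b * h" by (auto simp: I_def)
    then have "c * x = (c * a) * f + (c * b) * h" by (simp add: algebra_simps)
    then show ?thesis unfolding I_def by blast
  qed
  have "f = 1 * f + 0 * h" "h = 0 * f + 1 * h" by simp_all
  then have fI: "f \<in> I" and hI: "h \<in> I" unfolding I_def by blast+
  have f0: "f \<noteq> 0" using f(2) by auto
  define P where "P = (\<lambda>n. \<exists>g\<in>I. g \<noteq> 0 \<and> degree g = n)"
  have "P (degree f)" using fI f0 unfolding P_def by blast
  then have "P (LEAST n. P n)" by (rule LeastI)
  then obtain g where g: "g \<in> I" "g \<noteq> 0" "degree g = (LEAST n. P n)" unfolding P_def by blast
  have least: "degree g \<le> degree x" if "x \<in> I" "x \<noteq> 0" for x
    unfolding g(3) by (rule Least_le) (use that P_def in blast)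
  have divides: "\<exists>k. g dvd smult (lead_coeff g ^ k) x" if "x \<in> I" for x
  proof -
    \<comment> \<open>The coefficients form only a domain, so pseudo-division replaces division with
      remainder. The remainder lies in \<open>I\<close> and has smaller degree than \<open>g\<close>
      unless it is 0, so minimality makes it 0.\<close>
    obtain q r where qr: "pseudo_divmod x g = (q, r)" by fastforce
    define k where "k = Suc (degree x) - degree g"
    have eq: "smult (lead_coeff g ^ k) x = g * q + r"
      using pseudo_divmod(1)[OF g(2) qr] unfolding k_def .
    have "r = [:lead_coeff g ^ k:] * x + (- q) * g"
      using eq by (simp add: algebra_simps)
    then have "r \<in> I" using I_add I_mult that g(1) by metis
    then have "r = 0" using pseudo_divmod(2)[OF g(2) qr] least[of r] by fastforce
    then show ?thesis using eq by (intro exI[of _ k]) simp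
  qed
  have not_const: "\<not> f dvd [:c:]" if "c \<noteq> 0" for c
    using dvd_imp_degree_le[of f "[:c:]"] f(2) that by auto
  have f_dvd_smult: "f dvd x" if "f dvd smult c x" "c \<noteq> 0" for c x
  proof -
    have "f dvd [:c:] * x" using that(1) by simp
    then show ?thesis using f(1) not_const[OF that(2)] prime_elem_dvd_multD by blast
  qed
  obtain k where k: "g dvd smult (lead_coeff g ^ k) f" using divides[OF fI] by blast
  then obtain q where q: "smult (lead_coeff g ^ k) f = g * q" by (auto simp: dvd_def)
  have lc: "lead_coeff g ^ n \<noteq> 0" for n using g(2) by simp
  have "f dvd smult (lead_coeff g ^ k) f" by (rule dvd_smult) simp
  \<comment> \<open>If \<open>f\<close> divided \<open>g\<close>, it would divide a constant
    multiple of \<open>h\<close>, hence \<open>h\<close>. So it divides the cofactor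
    \<open>q\<close>, and cancelling \<open>f\<close> shows that \<open>g\<close> divides a
    constant.\<close>
  then have "f dvd g \<or> f dvd q" using q f(1) prime_elem_dvd_multD by metis
  moreover have "\<not> f dvd g"
  proof
    assume fg: "f dvd g"
    obtain j where j: "g dvd smult (lead_coeff g ^ j) h" using divides[OF hI] by blast
    with h f_dvd_smult[OF dvd_trans[OF fg j] lc] show False by blast
  qed
  ultimately obtain q' where "q = f * q'" by (auto simp: dvd_def)
  with q have "f * [:lead_coeff g ^ k:] = f * (g * q')" by (simp add: mult.commute mult.left_commute)
  then have "g * q' = [:lead_coeff g ^ k:]" using f0 by (metis mult_left_cancel)
  then have "g dvd [:lead_coeff g ^ k:]" by (metis dvd_triv_left)
  then have "degree g = 0" using dvd_imp_degree_le[of g "[:lead_coeff g ^ k:]"] lc by simp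
  then obtain r where "g = [:r:]" by (metis degree_eq_zeroE)
  with g(1,2) show ?thesis unfolding I_def by auto
qed

text \<open>The evaluations are kept as a set \<open>E\<close> of homomorphisms of an arbitrary
  domain, so that the property can be carried along when a variable is adjoined. The middle clause
  is needed there to find evaluations that do not kill a given element.\<close>

definition nullstellensatz :: "('a::idom \<Rightarrow> complex) set \<Rightarrow> bool" where
  "nullstellensatz E \<longleftrightarrow> (\<forall>e\<in>E. ring_homomorphism e) \<and> (\<forall>r. (\<forall>e\<in>E. e r = 0) \<longrightarrow> r = 0) \<and>
     (\<forall>f h. prime_elem f \<longrightarrow> (\<forall>e\<in>E. e f = 0 \<longrightarrow> e h = 0) \<longrightarrow> f dvd h)"

text \<open>A field has no prime elements, so the divisibility clause is vacuous.\<close>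

lemma nullstellensatz_field: "nullstellensatz {\<lambda>x::complex. x}"
proof -
  have "\<not> prime_elem f" for f :: complex
    unfolding prime_elem_def by (metis dvd_field_iff one_neq_zero)
  then show ?thesis by (simp add: nullstellensatz_def ring_homomorphism_id)
qed

lemma poly_extension_all_zero:
  assumes "ring_homomorphism e" and "\<And>c. poly_extension e c p = 0"
  shows "e (coeff p n) = (0::complex)"
proof -
  interpret ring_homomorphism e by fact
  have "map_poly e p = 0"
    using assms(2) poly_all_0_iff_0[of "map_poly e p"] unfolding poly_extension_def by blast
  then show ?thesis by (metis coeff_0 coeff_map_poly hom_zero)
qed

text \<open>The induction step: each evaluation is extended by a complex value for the new variable.
  A prime of positive degree is treated by elimination and the fundamental theorem of algebra, a
  constant prime coefficient by coefficient.\<close>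

lemma nullstellensatz_poly:
  fixes E :: "('a::{factorial_ring_gcd,semiring_gcd_mult_normalize} \<Rightarrow> complex) set"
  assumes E: "nullstellensatz E"
  shows "nullstellensatz {poly_extension e c | e c. e \<in> E}"
proof -
  from E have hom: "\<And>e. e \<in> E \<Longrightarrow> ring_homomorphism e"
    and faithful: "\<And>r. (\<And>e. e \<in> E \<Longrightarrow> e r = 0) \<Longrightarrow> r = 0"
    and null: "\<And>f h. prime_elem f \<Longrightarrow> (\<And>e. e \<in> E \<Longrightarrow> e f = 0 \<Longrightarrow> e h = 0) \<Longrightarrow> f dvd h"
    unfolding nullstellensatz_def by blast+
  have faithful': "p = 0" if "\<And>e c. e \<in> E \<Longrightarrow> poly_extension e c p = 0" for p
  proof (rule poly_eqI)
    fix n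
    have "e (coeff p n) = 0" if "e \<in> E" for e
      by (rule poly_extension_all_zero[OF hom[OF that]]) (rule \<open>\<And>e c. e \<in> E \<Longrightarrow> poly_extension e c p = 0\<close>[OF that])
    then have "coeff p n = 0" by (rule faithful)
    then show "coeff p n = coeff 0 n" by simp
  qed
  have null': "f dvd h"
    if f: "prime_elem f" and van: "\<And>e c. e \<in> E \<Longrightarrow> poly_extension e c f = 0 \<Longrightarrow> poly_extension e c h = 0"
    for f h
  proof (cases "degree f = 0")
    case True
    then obtain a where a: "f = [:a:]" by (metis degree_eq_zeroE)
    have "a dvd coeff h n" for n
    proof (rule null)
      show "prime_elem a" using f a by (simp add: prime_elem_const_poly_iff)
      fix e assume e: "e \<in> E" and ea: "e a = 0"
      interpret ring_homomorphism e by (rule hom[OF e])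
      have "poly_extension e c f = 0" for c by (simp add: a poly_extension_const ea)
      then show "e (coeff h n) = 0" using van[OF e] poly_extension_all_zero[OF hom[OF e]] by blast
    qed
    then show ?thesis by (simp add: a const_poly_dvd_iff)
  next
    case False
    show ?thesis
    proof (rule ccontr)
      assume "\<not> f dvd h"
      then obtain a b r where r: "r \<noteq> 0" "[:r:] = a * f + b * h"
        using prime_poly_eliminates[of f h] f False by auto
      \<comment> \<open>Keeping the leading coefficient nonzero preserves the positive degree of
        \<open>f\<close>, so the specialization has a root \<open>z\<close>. There \<open>f\<close>
        and \<open>h\<close> both vanish, which forces \<open>e r\<close> to be 0.\<close>
      have "r * lead_coeff f \<noteq> 0" using r False by auto
      then obtain e where e: "e \<in> E" "e (r * lead_coeff f) \<noteq> 0" using faithful by blast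
      interpret ring_homomorphism e by (rule hom[OF e(1)])
      have er: "e r \<noteq> 0" and el: "e (lead_coeff f) \<noteq> 0" using e(2) by (auto simp: hom_mult)
      have "degree (map_poly e f) \<noteq> 0" using map_poly_degree_eq[of e f, OF el] False by simp
      then obtain z where z: "poly_extension e z f = 0"
        unfolding poly_extension_def
        using fundamental_theorem_of_algebra[of "map_poly e f"] constant_degree[of "map_poly e f"] by metis
      then have "poly_extension e z h = 0" using van e by blast
      moreover have "e r = poly_extension e z a * poly_extension e z f
          + poly_extension e z b * poly_extension e z h"
        using arg_cong[OF r(2), of "poly_extension e z"]
        by (simp only: poly_extension_const poly_extension_add poly_extension_mult)
      ultimately show False using z er by simp
    qed
  qed
  let ?E = "{poly_extension e c | e c. e \<in> E}"
  have mem: "poly_extension e c \<in> ?E" if "e \<in> E" for e c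
    using that by blast
  show ?thesis
    unfolding nullstellensatz_def
  proof (intro conjI ballI allI impI)
    fix e assume "e \<in> ?E"
    then show "ring_homomorphism e"
      by (auto intro: ring_homomorphism.poly_extension_hom[OF hom])
  next
    fix p assume "\<forall>e\<in>?E. e p = 0"
    then show "p = 0" by (intro faithful') (use mem in blast)
  next
    fix f h assume "prime_elem f" "\<forall>e\<in>?E. e f = 0 \<longrightarrow> e h = 0"
    then show "f dvd h" by (intro null') (use mem in blast)+
  qed
qed

text \<open>Nesting univariate polynomial rings provides unique factorization for forms in four variables.\<close>

type_synonym nest = "complex poly poly poly poly"

definition nest_const :: "complex \<Rightarrow> nest" where
  "nest_const c = [:[:[:[:c:]:]:]:]"

definition nest_var :: "4 \<Rightarrow> nest" where
  "nest_var i = (if i = 1 then [:[:[:[:0, 1:]:]:]:] else if i = 2 then [:[:[:0, 1:]:]:]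
     else if i = 3 then [:[:0, 1:]:] else [:0, 1:])"

definition nest_eval :: "(complex \<Rightarrow> 'a::comm_ring_1) \<Rightarrow> (4 \<Rightarrow> 'a) \<Rightarrow> nest \<Rightarrow> 'a" where
  "nest_eval h x = poly_extension (poly_extension (poly_extension (poly_extension h (x 1)) (x 2)) (x 3)) (x 4)"

definition to_nest :: "4 cpoly \<Rightarrow> nest" where
  "to_nest = insertion nest_const nest_var"

definition of_nest :: "nest \<Rightarrow> 4 cpoly" where
  "of_nest = nest_eval Const Var"

lemma nest_const_hom: "ring_homomorphism nest_const"
  unfolding nest_const_def by unfold_locales (simp_all add: one_pCons)

lemma nest_eval_hom: "ring_homomorphism h \<Longrightarrow> ring_homomorphism (nest_eval h x)"
  unfolding nest_eval_def by (intro ring_homomorphism.poly_extension_hom)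

lemma nest_eval_const:
  assumes "ring_homomorphism h"
  shows "nest_eval h x (nest_const c) = h c"
  unfolding nest_eval_def nest_const_def
  by (simp add: ring_homomorphism.poly_extension_const ring_homomorphism.poly_extension_hom assms)

lemma numeral_4_distinct: "(1::4) \<noteq> 2" "(1::4) \<noteq> 3" "(1::4) \<noteq> 4" "(2::4) \<noteq> 3" "(2::4) \<noteq> 4" "(3::4) \<noteq> 4"
  "(2::4) \<noteq> 1" "(3::4) \<noteq> 1" "(4::4) \<noteq> 1" "(3::4) \<noteq> 2" "(4::4) \<noteq> 2" "(4::4) \<noteq> 3"
  by simp_all

lemma nest_eval_var:
  assumes "ring_homomorphism h"
  shows "nest_eval h x (nest_var i) = x i"
  unfolding nest_eval_def nest_var_def
  using exhaust_4[of i]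
  by (elim disjE) (simp_all add: numeral_4_distinct ring_homomorphism.poly_extension_const
    ring_homomorphism.poly_extension_var ring_homomorphism.poly_extension_hom assms)

lemma to_nest_hom: "ring_homomorphism to_nest"
  unfolding to_nest_def by (rule insertion_hom[OF nest_const_hom])

lemma of_nest_hom: "ring_homomorphism of_nest"
  unfolding of_nest_def by (rule nest_eval_hom[OF Const_hom])

interpretation to_nest: ring_homomorphism to_nest by (rule to_nest_hom)

interpretation of_nest: ring_homomorphism of_nest by (rule of_nest_hom)

lemma of_nest_to_nest [simp]: "of_nest (to_nest F) = F"
proof (rule cpoly_hom_eqI[of "\<lambda>F. of_nest (to_nest F)" "\<lambda>F. F"])
  show "ring_homomorphism (\<lambda>F. of_nest (to_nest F))"
    by (rule ring_homomorphism_comp[OF to_nest_hom of_nest_hom])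
  show "ring_homomorphism (\<lambda>F. F)"
    by (rule ring_homomorphism_id)
  show "of_nest (to_nest (Const c)) = Const c" for c
    unfolding to_nest_def of_nest_def
    by (simp add: insertion_Const nest_const_hom nest_eval_const Const_hom)
  show "of_nest (to_nest (Var i)) = Var i" for i
    unfolding to_nest_def of_nest_def
    by (simp add: insertion_Var nest_const_hom nest_eval_var Const_hom)
qed

lemma to_nest_of_nest [simp]: "to_nest (of_nest p) = p"
proof -
  define k where "k p = to_nest (of_nest p)" for p
  have k: "ring_homomorphism k"
    unfolding k_def by (rule ring_homomorphism_comp[OF of_nest_hom to_nest_hom])
  have k_const: "k (nest_const c) = nest_const c" for c
    unfolding k_def of_nest_def to_nest_def
    by (simp add: insertion_Const nest_const_hom nest_eval_const Const_hom)
  have k_var: "k (nest_var i) = nest_var i" for i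
    unfolding k_def of_nest_def to_nest_def
    by (simp add: insertion_Var nest_const_hom nest_eval_var Const_hom)
  \<comment> \<open>\<open>k\<close> is compared with the identity one variable at a time, starting
    with the innermost coefficient ring and working outwards.\<close>
  have c: "ring_homomorphism (\<lambda>a. l [:a:])" if "ring_homomorphism l" for l :: "'c::comm_ring_1 poly \<Rightarrow> nest"
    by (rule ring_homomorphism_comp[OF ring_homomorphism_const_poly that])
  note k3 = c[OF k] and i3 = c[OF ring_homomorphism_id]
  note k2 = c[OF k3] and i2 = c[OF i3]
  note k1 = c[OF k2] and i1 = c[OF i2]
  have 1: "k [:[:[:p:]:]:] = [:[:[:p:]:]:]" for p
    by (rule poly_hom_eqI[OF k1 i1])
      (use k_const k_var[of 1] in \<open>simp_all add: nest_const_def nest_var_def\<close>)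
  have 2: "k [:[:p:]:] = [:[:p:]:]" for p
    by (rule poly_hom_eqI[OF k2 i2])
      (use 1 k_var[of 2] in \<open>simp_all add: nest_var_def numeral_4_distinct\<close>)
  have 3: "k [:p:] = [:p:]" for p
    by (rule poly_hom_eqI[OF k3 i3])
      (use 2 k_var[of 3] in \<open>simp_all add: nest_var_def numeral_4_distinct\<close>)
  have "k p = p"
    by (rule poly_hom_eqI[OF k ring_homomorphism_id])
      (use 3 k_var[of 4] in \<open>simp_all add: nest_var_def numeral_4_distinct\<close>)
  then show ?thesis by (simp add: k_def)
qed

lemma to_nest_dvd_iff: "to_nest F dvd to_nest G \<longleftrightarrow> F dvd G"
  by (metis of_nest.hom_dvd of_nest_to_nest to_nest.hom_dvd)

lemma irreducible_to_nest:
  assumes "irreducible F"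
  shows "irreducible (to_nest F)"
proof (rule irreducibleI)
  show "to_nest F \<noteq> 0"
    using assms by (metis irreducible_def of_nest.hom_zero of_nest_to_nest)
  show "\<not> to_nest F dvd 1"
    using assms to_nest_dvd_iff[of F 1] by (simp add: irreducible_def to_nest.hom_one)
  fix a b assume "to_nest F = a * b"
  then have "F = of_nest a * of_nest b"
    by (metis of_nest.hom_mult of_nest_to_nest)
  then have "of_nest a dvd 1 \<or> of_nest b dvd 1"
    using assms by (simp add: irreducible_def)
  then show "a dvd 1 \<or> b dvd 1"
    by (metis to_nest.hom_dvd to_nest.hom_one to_nest_of_nest)
qed

lemma nullstellensatz_nest: "nullstellensatz {nest_eval (\<lambda>c. c) x | x. True}"
proof -
  let ?E = "{nest_eval (\<lambda>c::complex. c) x | x. True}"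
  let ?S = "\<lambda>E. {poly_extension e c | e c. e \<in> E}"
  have "nullstellensatz (?S (?S (?S (?S {\<lambda>c::complex. c}))))"
    by (intro nullstellensatz_poly nullstellensatz_field)
  moreover have "?S (?S (?S (?S {\<lambda>c::complex. c}))) = ?E"
  proof (intro set_eqI iffI)
    fix e assume "e \<in> ?S (?S (?S (?S {\<lambda>c::complex. c})))"
    then obtain a b c d where
      e: "e = poly_extension (poly_extension (poly_extension (poly_extension (\<lambda>c::complex. c) a) b) c) d"
      by blast
    have "e = nest_eval (\<lambda>c. c) (\<lambda>i. if i = 1 then a else if i = 2 then b else if i = 3 then c else d)"
      unfolding e nest_eval_def by (simp add: numeral_4_distinct)
    then show "e \<in> ?E" by blast
  next
    fix e assume "e \<in> ?E"
    then show "e \<in> ?S (?S (?S (?S {\<lambda>c::complex. c})))" unfolding nest_eval_def by blast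
  qed
  ultimately show ?thesis by simp
qed

lemma nest_eval_to_nest: "nest_eval (\<lambda>c. c) x (to_nest F) = poly_value F (vec_lambda x)"
proof (rule cpoly_hom_eqI[of "\<lambda>F. nest_eval (\<lambda>c. c) x (to_nest F)" "\<lambda>F. poly_value F (vec_lambda x)"])
  show "ring_homomorphism (\<lambda>F. nest_eval (\<lambda>c::complex. c) x (to_nest F))"
    by (rule ring_homomorphism_comp[OF to_nest_hom nest_eval_hom[OF ring_homomorphism_id]])
qed (simp_all add: ring_homomorphism_id poly_value_hom to_nest_def insertion_Const insertion_Var
  nest_const_hom nest_eval_const nest_eval_var)

lemma poly_value_all_0:
  fixes F :: "4 cpoly"
  assumes "\<And>v. poly_value F v = 0"
  shows "F = 0"
proof -
  have "e (to_nest F) = 0" if "e \<in> {nest_eval (\<lambda>c. c) x | x. True}" for e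
    using that assms by (auto simp: nest_eval_to_nest)
  then have "to_nest F = 0"
    using nullstellensatz_nest unfolding nullstellensatz_def by blast
  then show ?thesis by (metis of_nest.hom_zero of_nest_to_nest)
qed

lemma irreducible_dvd_if_vanishing:
  fixes F H :: "4 cpoly"
  assumes "irreducible F" and "\<And>v. poly_value F v = 0 \<Longrightarrow> poly_value H v = 0"
  shows "F dvd H"
proof -
  have "prime_elem (to_nest F)"
    using irreducible_to_nest[OF assms(1)] by (simp add: prime_elem_iff_irreducible)
  moreover have "e (to_nest H) = 0"
    if "e \<in> {nest_eval (\<lambda>c. c) x | x. True}" "e (to_nest F) = 0" for e
    using that assms(2) by (auto simp: nest_eval_to_nest)
  ultimately have "to_nest F dvd to_nest H"
    using nullstellensatz_nest unfolding nullstellensatz_def by blast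
  then show ?thesis by (simp add: to_nest_dvd_iff)
qed

lemma irreducible_dvd_mult:
  fixes F G H :: "4 cpoly"
  assumes "irreducible F" "F dvd G * H"
  shows "F dvd G \<or> F dvd H"
proof -
  have "prime_elem (to_nest F)"
    using irreducible_to_nest[OF assms(1)] by (simp add: prime_elem_iff_irreducible)
  moreover have "to_nest F dvd to_nest G * to_nest H"
    using assms(2) by (metis to_nest.hom_mult to_nest.hom_dvd)
  ultimately show ?thesis using prime_elem_dvd_multD to_nest_dvd_iff by blast
qed

section \<open>Homogeneous polynomials\<close>

text \<open>\<open>grade F\<close> is \<open>F\<close> with every variable \<open>x\<close> replaced by \<open>x t\<close>, so that its coefficient at
  \<open>t\<^sup>d\<close> is the component of degree \<open>d\<close>.\<close>

definition grade :: "'n::finite cpoly \<Rightarrow> 'n cpoly poly" where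
  "grade = insertion (\<lambda>c. [:Const c:]) (\<lambda>i. [:0, Var i:])"

lemma grade_const_hom: "ring_homomorphism (\<lambda>c. [:Const c :: 'n::finite cpoly:])"
  by (rule ring_homomorphism_comp[OF Const_hom ring_homomorphism_const_poly])

lemma grade_hom: "ring_homomorphism grade"
  unfolding grade_def by (rule insertion_hom[OF grade_const_hom])

interpretation grade: ring_homomorphism grade by (rule grade_hom)

lemma grade_single:
  fixes m :: "'n::finite \<Rightarrow>\<^sub>0 nat"
  shows "grade (Poly_Mapping.single m c) =
    monom (Poly_Mapping.single m c) (\<Sum>i\<in>UNIV. Poly_Mapping.lookup m i)"
proof -
  have eq: "[:0, Var i:] = monom (Var i) 1" for i :: 'n
    by (simp add: monom_altdef)
  have prod: "(\<Prod>i\<in>I. monom (x i) (e i)) = monom (\<Prod>i\<in>I. x i) (\<Sum>i\<in>I. e i)"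
    for I :: "'n set" and x :: "'n \<Rightarrow> 'n cpoly" and e
    by (induction I rule: infinite_finite_induct) (simp_all add: mult_monom)
  show ?thesis
    unfolding grade_def insertion_single[OF grade_const_hom] eq monom_power prod
    by (simp add: single_eq_monomial[of m c] smult_monom)
qed

lemma lookup_coeff_grade:
  "Poly_Mapping.lookup (coeff (grade F) k) m =
    (if (\<Sum>i\<in>UNIV. Poly_Mapping.lookup m i) = k then Poly_Mapping.lookup F m else 0)"
  by (induction F rule: cpoly_induct)
    (auto simp: grade_single grade.hom_add lookup_add lookup_single when_def)

text \<open>Homogeneity becomes an equation about the ring homomorphism \<open>grade\<close>, so the
  closure properties below are computations with monomials in one variable.\<close>

lemma homogeneous_iff_grade: "homogeneous d F \<longleftrightarrow> grade F = monom F d"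
proof
  assume F: "homogeneous d F"
  show "grade F = monom F d"
  proof (rule poly_eqI, rule poly_mapping_eqI)
    fix k m
    show "Poly_Mapping.lookup (coeff (grade F) k) m = Poly_Mapping.lookup (coeff (monom F d) k) m"
      using F by (auto simp: lookup_coeff_grade homogeneous_def in_keys_iff)
  qed
next
  assume F: "grade F = monom F d"
  have "(\<Sum>i\<in>UNIV. Poly_Mapping.lookup m i) = d" if "m \<in> Poly_Mapping.keys F" for m
    using lookup_coeff_grade[of F d m] that by (auto simp: F in_keys_iff split: if_splits)
  then show "homogeneous d F" by (simp add: homogeneous_def)
qed

lemma homogeneous_0: "homogeneous d 0"
  by (simp add: homogeneous_def)

lemma homogeneous_add: "homogeneous d F \<Longrightarrow> homogeneous d G \<Longrightarrow> homogeneous d (F + G)"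
  by (simp add: homogeneous_iff_grade grade.hom_add add_monom)

lemma homogeneous_diff: "homogeneous d F \<Longrightarrow> homogeneous d G \<Longrightarrow> homogeneous d (F - G)"
  by (simp add: homogeneous_iff_grade grade.hom_diff diff_monom)

lemma homogeneous_mult: "homogeneous d F \<Longrightarrow> homogeneous e G \<Longrightarrow> homogeneous (d + e) (F * G)"
  by (simp add: homogeneous_iff_grade grade.hom_mult mult_monom)

lemma homogeneous_Const: "homogeneous 0 (Const c)"
  by (simp add: homogeneous_def Const_def)

lemma homogeneous_1: "homogeneous 0 1"
  using homogeneous_Const[of 1] by (simp add: Const.hom_one)

lemma homogeneous_Var: "homogeneous 1 (Var i)"
  by (simp add: homogeneous_def Var_def lookup_single when_def)

lemma homogeneous_sum: "(\<And>i. i \<in> I \<Longrightarrow> homogeneous d (f i)) \<Longrightarrow> homogeneous d (\<Sum>i\<in>I. f i)"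
  by (induction I rule: infinite_finite_induct) (auto intro: homogeneous_0 homogeneous_add)

lemma homogeneous_prod:
  "(\<And>i. i \<in> I \<Longrightarrow> homogeneous (e i) (f i)) \<Longrightarrow> homogeneous (\<Sum>i\<in>I. e i) (\<Prod>i\<in>I. f i)"
  by (induction I rule: infinite_finite_induct) (auto intro: homogeneous_1 homogeneous_mult)

lemma homogeneous_power: "homogeneous e F \<Longrightarrow> homogeneous (n * e) (F ^ n)"
  by (induction n) (auto intro: homogeneous_1 homogeneous_mult)

lemma homogeneous_unique:
  assumes "F \<noteq> 0" "homogeneous d F" "homogeneous e F"
  shows "d = e"
proof -
  have "monom F d = monom F e"
    using assms(2,3) by (simp add: homogeneous_iff_grade)
  then show ?thesis
    using assms(1) by (metis degree_monom_eq)
qed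

lemma poly_value_scale:
  assumes "homogeneous d F"
  shows "poly_value F (c *s v) = c ^ d * poly_value F v"
proof -
  have "(\<Prod>i\<in>UNIV. ((c *s v) $ i) ^ Poly_Mapping.lookup m i) =
      c ^ d * (\<Prod>i\<in>UNIV. (v $ i) ^ Poly_Mapping.lookup m i)" if "m \<in> Poly_Mapping.keys F" for m
    using assms that by (simp add: homogeneous_def power_mult_distrib prod.distrib power_sum[symmetric])
  then show ?thesis
    by (simp add: poly_value_def sum_distrib_left algebra_simps)
qed

lemma poly_value_scale_grade:
  "poly_value F (c *s v) = poly_extension (\<lambda>G. poly_value G v) c (grade F)"
proof (rule cpoly_hom_eqI[of "\<lambda>F. poly_value F (c *s v)" "\<lambda>F. poly_extension (\<lambda>G. poly_value G v) c (grade F)"])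
  show "ring_homomorphism (\<lambda>F. poly_extension (\<lambda>G. poly_value G v) c (grade F))"
    by (rule ring_homomorphism_comp[OF grade_hom poly_value.poly_extension_hom])
qed (simp_all add: poly_value_hom grade_def insertion_Const insertion_Var grade_const_hom
  poly_value.poly_extension_const poly_value.poly_extension_pCons poly_value.poly_extension_0
  poly_value.hom_zero)

text \<open>Recognizes a form by its values alone. Both sides are compared as polynomials in
  \<open>c\<close>, one vector \<open>v\<close> at a time.\<close>

lemma homogeneousI_scale:
  fixes F :: "4 cpoly"
  assumes "\<And>c v. c \<noteq> 0 \<Longrightarrow> poly_value F (c *s v) = c ^ d * poly_value F v"
  shows "homogeneous d F"
proof -
  have coeff: "poly_value (coeff (grade F) k) v = coeff (monom (poly_value F v) d) k" for k v
  proof -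
    let ?P = "map_poly (\<lambda>G. poly_value G v) (grade F)" and ?Q = "monom (poly_value F v) d"
    \<comment> \<open>The hypothesis says nothing about \<open>c = 0\<close>; the extra factor
      vanishes there and is cancelled afterwards.\<close>
    have "poly ([:0, 1:] * (?P - ?Q)) c = 0" for c
      using assms[of c v] by (auto simp: poly_value_scale_grade poly_extension_def poly_monom mult.commute)
    then have "[:0, 1:] * (?P - ?Q) = 0"
      using poly_all_0_iff_0[of "[:0, 1:] * (?P - ?Q)"] by blast
    then have "?P = ?Q" by (simp del: mult_pCons_left)
    then show ?thesis
      by (metis coeff_map_poly poly_value.hom_zero)
  qed
  have "grade F = monom F d"
  proof (rule poly_eqI)
    fix k
    have "coeff (grade F) k - coeff (monom F d) k = 0"
      by (rule poly_value_all_0) (simp add: poly_value.hom_diff coeff poly_value.hom_zero)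
    then show "coeff (grade F) k = coeff (monom F d) k" by simp
  qed
  then show ?thesis by (simp add: homogeneous_iff_grade)
qed

text \<open>Both the order at 0 and the degree are additive and the order never exceeds the degree.
  They coincide for a monomial, so they coincide for each of its factors.\<close>

lemma monom_factor:
  fixes p q :: "'a::idom poly"
  assumes "p * q = monom c d" "c \<noteq> 0"
  shows "p = monom (lead_coeff p) (degree p)"
proof -
  have nz: "p * q \<noteq> 0" using assms by simp
  then have nz': "p \<noteq> 0" "q \<noteq> 0" by auto
  have "order 0 p + order 0 q = degree p + degree q"
    using order_mult[OF nz, of 0] degree_mult_eq[OF nz'] assms
    by (simp add: order_0_monom degree_monom_eq)
  then have "order 0 p = degree p"
    using order_degree[OF nz'(1), of 0] order_degree[OF nz'(2), of 0] by simp
  then have "[:- 0, 1:] ^ degree p dvd p"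
    using order_1[of 0 p] by simp
  then obtain r where r: "p = [:0, 1:] ^ degree p * r" by (auto simp: dvd_def)
  then have "r \<noteq> 0" using nz' by auto
  then have "degree r = 0"
    using arg_cong[OF r, of degree] by (simp add: degree_mult_eq degree_power_eq)
  then obtain a where "r = [:a:]" by (metis degree_eq_zeroE)
  then have p: "p = monom a (degree p)"
    using r by (simp add: monom_altdef)
  then have "lead_coeff p = a" by (metis coeff_monom)
  with p show ?thesis by simp
qed

text \<open>A factor of a form is graded by a single power, since its \<open>grade\<close> divides a
  monomial. The sort \<open>linorder\<close> orders the exponent vectors and thereby excludes zero
  divisors.\<close>

lemma homogeneous_factor:
  fixes F G :: "'n::{finite,linorder} cpoly"
  assumes "homogeneous d (F * G)" "F * G \<noteq> 0"
  shows "\<exists>a. homogeneous a F"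
proof -
  have "grade F * grade G = monom (F * G) d"
    using assms(1) by (simp add: homogeneous_iff_grade grade.hom_mult)
  then have F: "grade F = monom (lead_coeff (grade F)) (degree (grade F))"
    by (rule monom_factor[OF _ assms(2)])
  have "poly (grade H) 1 = H" for H :: "'n cpoly"
  proof (rule cpoly_hom_eqI[of "\<lambda>H. poly (grade H) 1" "\<lambda>H. H"])
    show "ring_homomorphism (\<lambda>H::'n cpoly. poly (grade H) 1)"
      by (rule ring_homomorphism_comp[OF grade_hom ring_homomorphism_poly])
  qed (simp_all add: ring_homomorphism_id grade_def insertion_Const insertion_Var grade_const_hom)
  then have "lead_coeff (grade F) = F"
    using F by (metis mult.right_neutral poly_monom power_one)
  with F show ?thesis by (metis homogeneous_iff_grade)
qed

lemma homogeneous_factors: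
  fixes F G :: "'n::{finite,linorder} cpoly"
  assumes "homogeneous d (F * G)" "F * G \<noteq> 0"
  obtains a b where "homogeneous a F" "homogeneous b G" "a + b = d"
proof -
  obtain a where a: "homogeneous a F"
    using homogeneous_factor[OF assms] by blast
  obtain b where b: "homogeneous b G"
    using homogeneous_factor[of d G F] assms by (auto simp: mult.commute)
  have "a + b = d"
    by (rule homogeneous_unique[OF assms(2) homogeneous_mult[OF a b] assms(1)])
  with a b that show ?thesis by blast
qed

lemma homogeneous_dvd_degree_le:
  fixes F H :: "'n::{finite,linorder} cpoly"
  assumes "homogeneous d F" "homogeneous e H" "F dvd H" "H \<noteq> 0"
  shows "d \<le> e"
proof -
  obtain K where K: "H = F * K" using assms(3) by (auto simp: dvd_def)
  obtain a b where "homogeneous a F" "homogeneous b K" "a + b = e"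
    using homogeneous_factors assms(2,4) unfolding K by metis
  then show ?thesis
    using homogeneous_unique[of F a d] assms(1,4) K by auto
qed

text \<open>\<open>B\<close> is \<open>A\<close> divided by the greatest common divisor of its
  entries. The last conclusion is what makes it useful: every tuple proportional to \<open>B\<close>
  is a polynomial multiple of \<open>B\<close>, so \<open>B\<close> cannot vanish where such a tuple
  does not.\<close>

lemma common_factor:
  fixes A :: "4 \<Rightarrow> 4 cpoly"
  assumes A: "\<And>i. homogeneous d (A i)" "A i0 \<noteq> 0"
  obtains g B e where "\<And>i. A i = g * B i" "\<And>i. homogeneous e (B i)" "g \<noteq> 0"
    and "\<And>C. (\<And>i j. B i * C j = B j * C i) \<Longrightarrow> \<exists>h. \<forall>i. C i = h * B i"
proof -
  define a where "a i = to_nest (A i)" for i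
  define g where "g = Gcd_fin (range a)"
  have "\<exists>b. a i = g * b" for i
    using Gcd_fin_dvd[of "a i" "range a"] by (auto simp: g_def dvd_def)
  then obtain b where b: "\<And>i. a i = g * b i" by metis
  have a0: "a i0 \<noteq> 0"
    unfolding a_def using A(2) by (metis of_nest.hom_zero of_nest_to_nest)
  have g0: "g \<noteq> 0" and b0: "b i0 \<noteq> 0" using a0 b[of i0] by auto
  have fin: "finite (range b)" by simp
  have unit: "normalize (c * Gcd_fin (range b)) = normalize c" for c
  proof -
    have "range a = (*) g ` range b"
      using b by (auto simp: image_image)
    then have "g = Gcd_fin ((*) g ` range b)"
      by (simp only: g_def)
    then have "g = normalize (g * Gcd_fin (range b))"
      using Gcd_fin_mult[OF fin, of g] by simp
    then have "g * Gcd_fin (range b) dvd g * 1" by (metis dvd_refl mult.right_neutral normalize_dvd_iff)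
    then have "Gcd_fin (range b) dvd 1" using g0 by (metis dvd_mult_cancel_left)
    then have "Gcd_fin (range b) = 1" by (simp only: is_unit_Gcd_fin_iff)
    then show ?thesis by simp
  qed
  define g' where "g' = of_nest g"
  define B where "B i = of_nest (b i)" for i
  have AB: "A i = g' * B i" for i
    unfolding g'_def B_def of_nest.hom_mult[symmetric] b[symmetric] a_def by simp
  have g'0: "g' \<noteq> 0" using AB A(2) by auto
  have B0: "B i0 \<noteq> 0" using AB[of i0] A(2) by auto
  have "homogeneous d (g' * B i0)" "g' * B i0 \<noteq> 0"
    using A AB by metis+
  then obtain k e where k: "homogeneous k g'" "homogeneous e (B i0)" "k + e = d"
    by (rule homogeneous_factors)
  have hom: "homogeneous e (B i)" for i
  proof (cases "A i = 0")
    case True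
    then have "B i = 0" using AB[of i] g'0 by simp
    then show ?thesis by (simp add: homogeneous_0)
  next
    case False
    then have "homogeneous d (g' * B i)" "g' * B i \<noteq> 0" using A(1) AB by metis+
    then obtain k' e' where k': "homogeneous k' g'" "homogeneous e' (B i)" "k' + e' = d"
      by (rule homogeneous_factors)
    have "e' = e"
      using homogeneous_unique[OF g'0 k(1) k'(1)] k(3) k'(3) by linarith
    with k'(2) show ?thesis by simp
  qed
  have "\<exists>h. \<forall>i. C i = h * B i" if C: "\<And>i j. B i * C j = B j * C i" for C
  proof -
    \<comment> \<open>Dividing all these products, \<open>b i0\<close> divides their greatest common
      divisor, which is the common factor \<open>to_nest (C i0)\<close> up to a unit because the
      \<open>b i\<close> have greatest common divisor 1.\<close>
    have "b i0 dvd b i * to_nest (C i0)" for i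
    proof -
      have "b i0 * to_nest (C i) = b i * to_nest (C i0)"
        using arg_cong[OF C[of i0 i], of to_nest] by (simp add: to_nest.hom_mult B_def)
      then show ?thesis by (metis dvd_triv_left)
    qed
    then have "b i0 dvd Gcd_fin ((*) (to_nest (C i0)) ` range b)"
      by (subst dvd_Gcd_fin_iff) (auto simp: mult.commute)
    then have "b i0 dvd to_nest (C i0)"
      by (simp only: Gcd_fin_mult[OF fin] unit dvd_normalize_iff)
    then have "B i0 dvd C i0" unfolding B_def by (metis of_nest.hom_dvd of_nest_to_nest)
    then obtain h where h: "C i0 = h * B i0" by (auto simp: dvd_def mult.commute)
    have "B i0 * C i = B i0 * (h * B i)" for i
      using C[of i0 i] h by (simp add: ac_simps)
    then show ?thesis using B0 by (metis mult_left_cancel)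
  qed
  with AB hom g'0 that show ?thesis by blast
qed

section \<open>The Zariski topology\<close>

lemma proportional_refl: "proportional v v \<longleftrightarrow> v \<noteq> 0"
  unfolding proportional_def by (metis one_neq_zero vector_smult_lid)

lemma point_eq_iff:
  assumes "v \<noteq> 0" "w \<noteq> 0"
  shows "point v = point w \<longleftrightarrow> (\<exists>c. c \<noteq> 0 \<and> w = c *s v)"
  using Quotient3_rel[OF Quotient3_proj, of v w] assms
  by (simp add: proportional_refl) (simp add: proportional_def)

lemma point_scale: "c \<noteq> 0 \<Longrightarrow> v \<noteq> 0 \<Longrightarrow> point (c *s v) = point v"
  using point_eq_iff[of v "c *s v"] by auto

lemma point_cases [cases type: proj]:
  obtains v where "v \<noteq> 0" "p = point v"
  by (metis Quotient3_abs_rep Quotient3_proj Quotient3_rep_reflp proportional_refl)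

lemma point_in_zeros_iff:
  assumes "homogeneous d F" "v \<noteq> 0"
  shows "point v \<in> zeros F \<longleftrightarrow> poly_value F v = 0"
proof
  assume "point v \<in> zeros F"
  then obtain w where "w \<noteq> 0" "poly_value F w = 0" "point v = point w"
    by (auto simp: zeros_def)
  then show "poly_value F v = 0"
    using point_eq_iff[of w v] assms by (auto simp: poly_value_scale)
qed (use assms in \<open>auto simp: zeros_def\<close>)

lemma zeros_mult:
  assumes "homogeneous d F" "homogeneous e G"
  shows "zeros (F * G) = zeros F \<union> zeros G"
proof (rule set_eqI)
  fix p :: "'a proj"
  obtain v where "v \<noteq> 0" "p = point v" by (rule point_cases)
  then show "p \<in> zeros (F * G) \<longleftrightarrow> p \<in> zeros F \<union> zeros G"
    using assms homogeneous_mult[OF assms] by (simp add: point_in_zeros_iff poly_value.hom_mult)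
qed

lemma openin_zariski_iff:
  "openin zariski U \<longleftrightarrow> (\<forall>p\<in>U. \<exists>F d. homogeneous d F \<and> p \<notin> zeros F \<and> - zeros F \<subseteq> U)"
    (is "_ \<longleftrightarrow> ?R U")
proof
  assume "openin zariski U"
  then have "generate_topology_on {- zeros F | F. \<exists>d. homogeneous d F} U"
    unfolding zariski_def by (simp add: openin_topology_generated_by_iff)
  then show "?R U"
  proof induction
    case (Int a b)
    show ?case
    proof
      fix p assume p: "p \<in> a \<inter> b"
      then obtain F d where F: "homogeneous d F" "p \<notin> zeros F" "- zeros F \<subseteq> a" using Int.IH by blast
      from p obtain G e where G: "homogeneous e G" "p \<notin> zeros G" "- zeros G \<subseteq> b" using Int.IH by blast
      have "homogeneous (d + e) (F * G)" "p \<notin> zeros (F * G)" "- zeros (F * G) \<subseteq> a \<inter> b"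
        using F G homogeneous_mult[OF F(1) G(1)] zeros_mult[OF F(1) G(1)] by auto
      then show "\<exists>F d. homogeneous d F \<and> p \<notin> zeros F \<and> - zeros F \<subseteq> a \<inter> b" by blast
    qed
  next
    case (UN K)
    show ?case
    proof
      fix p assume "p \<in> \<Union>K"
      then obtain k where k: "k \<in> K" "p \<in> k" by blast
      then obtain F d where "homogeneous d F" "p \<notin> zeros F" "- zeros F \<subseteq> k" using UN.IH by blast
      then show "\<exists>F d. homogeneous d F \<and> p \<notin> zeros F \<and> - zeros F \<subseteq> \<Union>K" using k by blast
    qed
  qed blast+
next
  assume R: "?R U"
  have basis: "openin zariski (- zeros F)" if "homogeneous d F" for F :: "'a cpoly" and d
    unfolding zariski_def openin_topology_generated_by_iff
    by (rule generate_topology_on.Basis) (use that in blast)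
  show "openin zariski U"
    by (subst openin_subopen) (use R basis in blast)
qed

lemma open_nonzeros: "homogeneous d F \<Longrightarrow> openin zariski (- zeros F)"
  by (auto simp: openin_zariski_iff)

lemma openin_zariski_UNIV: "openin zariski (UNIV :: 'n::finite proj set)"
proof -
  have "zeros (1 :: 'n cpoly) = {}" by (simp add: zeros_def poly_value.hom_one)
  then show ?thesis using open_nonzeros[OF homogeneous_1, where 'a = 'n] by simp
qed

lemma topspace_zariski: "topspace zariski = UNIV"
  using openin_zariski_UNIV openin_subset by blast

lemma closedin_zeros: "homogeneous d F \<Longrightarrow> closedin zariski (zeros F)"
  by (simp add: closedin_def topspace_zariski Compl_eq_Diff_UNIV[symmetric] open_nonzeros)

lemma poly_value_all_nonzero_0:
  fixes F :: "4 cpoly"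
  assumes "\<And>v. v \<noteq> 0 \<Longrightarrow> poly_value F v = 0"
  shows "F = 0"
proof -
  \<comment> \<open>The factor \<open>Var 1\<close> takes care of the origin, which the hypothesis
    omits.\<close>
  have "Var 1 * F = 0"
  proof (rule poly_value_all_0)
    fix v
    show "poly_value (Var 1 * F) v = 0"
      using assms[of v] by (cases "v = 0") (simp_all add: poly_value.hom_mult)
  qed
  moreover have "Var (1::4) \<noteq> 0"
    by (metis poly_value_Var poly_value.hom_zero one_index zero_neq_one)
  ultimately show ?thesis by simp
qed

lemma vanishing_on_open:
  fixes H :: "4 cpoly"
  assumes "openin zariski U" "U \<noteq> {}" and H: "\<And>v. v \<noteq> 0 \<Longrightarrow> point v \<in> U \<Longrightarrow> poly_value H v = 0"
  shows "H = 0"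
proof -
  obtain p where "p \<in> U" using assms(2) by blast
  then obtain F d where F: "homogeneous d F" "p \<notin> zeros F" "- zeros F \<subseteq> U"
    using assms(1) by (auto simp: openin_zariski_iff)
  have "F * H = 0"
  proof (rule poly_value_all_nonzero_0)
    fix v :: "complex ^ 4" assume v: "v \<noteq> 0"
    show "poly_value (F * H) v = 0"
      using H[OF v] F(3) point_in_zeros_iff[OF F(1) v] by (auto simp: poly_value.hom_mult)
  qed
  moreover have "F \<noteq> 0"
  proof
    assume "F = 0"
    then have "p \<in> zeros F" by (cases p) (auto simp: zeros_def poly_value.hom_zero)
    with F(2) show False ..
  qed
  ultimately show ?thesis by simp
qed

lemma open_meet:
  fixes U V :: "4 proj set"
  assumes "openin zariski U" "openin zariski V" "U \<noteq> {}" "V \<noteq> {}"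
  shows "U \<inter> V \<noteq> {}"
proof
  assume disj: "U \<inter> V = {}"
  obtain p where p: "p \<in> U" using assms(3) by blast
  then obtain F d where F: "homogeneous d F" "p \<notin> zeros F" "- zeros F \<subseteq> U"
    using assms(1) by (auto simp: openin_zariski_iff)
  have "F = 0"
    by (rule vanishing_on_open[OF assms(2,4)]) (use disj F point_in_zeros_iff[OF F(1)] in auto)
  then have "p \<in> zeros F" by (cases p) (auto simp: zeros_def poly_value.hom_zero)
  with F(2) show False ..
qed

lemma irreducible_dvd_if_vanishing_on_open:
  fixes F H :: "4 cpoly"
  assumes F: "irreducible F" "homogeneous d F" and U: "openin zariski U" "zeros F \<inter> U \<noteq> {}"
    and H: "\<And>v. v \<noteq> 0 \<Longrightarrow> point v \<in> zeros F \<inter> U \<Longrightarrow> poly_value H v = 0"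
  shows "F dvd H"
proof (rule ccontr)
  assume not_dvd: "\<not> F dvd H"
  obtain p where p: "p \<in> zeros F" "p \<in> U" using U(2) by blast
  then obtain G e where G: "homogeneous e G" "p \<notin> zeros G" "- zeros G \<subseteq> U"
    using U(1) by (auto simp: openin_zariski_iff)
  obtain v where v: "v \<noteq> 0" "p = point v" by (rule point_cases)
  have Fv: "poly_value F v = 0" and Gv: "poly_value G v \<noteq> 0"
    using p(1) G(2) v point_in_zeros_iff[OF F(2)] point_in_zeros_iff[OF G(1)] by auto
  have zero: "poly_value K v = 0" if "F dvd K" for K
    using that Fv by (auto simp: dvd_def poly_value.hom_mult)
  obtain i where i: "v $ i \<noteq> 0" using v(1) by (auto simp: vec_eq_iff)
  \<comment> \<open>\<open>G\<close> vanishes off a principal part of \<open>U\<close>, and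
    \<open>Var i\<close> vanishes at the origin, which represents no point. \<open>F\<close> divides
    neither of them, as both are nonzero at the point \<open>v\<close> of the hypersurface.\<close>
  have "F dvd G * H * Var i"
  proof (rule irreducible_dvd_if_vanishing[OF F(1)])
    fix w assume w: "poly_value F w = 0"
    show "poly_value (G * H * Var i) w = 0"
    proof (cases "w = 0 \<or> poly_value G w = 0")
      case False
      then have "point w \<in> zeros F \<inter> U"
        using w G(3) point_in_zeros_iff[OF F(2)] point_in_zeros_iff[OF G(1)] by auto
      then show ?thesis using H False by (simp add: poly_value.hom_mult)
    qed (auto simp: poly_value.hom_mult)
  qed
  then have "F dvd G \<or> F dvd H \<or> F dvd Var i"
    using irreducible_dvd_mult[OF F(1)] by blast
  then show False using not_dvd zero[of G] zero[of "Var i"] Gv i by auto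
qed

lemma closure_of_open_part:
  fixes F :: "4 cpoly"
  assumes F: "irreducible F" "homogeneous d F" and U: "openin zariski U" "zeros F \<inter> U \<noteq> {}"
  shows "zariski closure_of (zeros F \<inter> U) = zeros F"
proof
  show "zariski closure_of (zeros F \<inter> U) \<subseteq> zeros F"
    by (rule closure_of_minimal) (auto intro: closedin_zeros[OF F(2)])
  show "zeros F \<subseteq> zariski closure_of (zeros F \<inter> U)"
  proof
    fix p assume p: "p \<in> zeros F"
    have "\<exists>q. q \<in> zeros F \<inter> U \<and> q \<in> N" if N: "p \<in> N" "openin zariski N" for N
    proof (rule ccontr)
      assume disj: "\<not> ?thesis"
      obtain G e where G: "homogeneous e G" "p \<notin> zeros G" "- zeros G \<subseteq> N"
        using N by (auto simp: openin_zariski_iff)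
      have "F dvd G"
        by (rule irreducible_dvd_if_vanishing_on_open[OF F U])
          (use disj G point_in_zeros_iff[OF G(1)] in blast)
      then obtain K where K: "G = F * K" by (auto simp: dvd_def)
      obtain v where v: "v \<noteq> 0" "p = point v" by (rule point_cases)
      show False
        using p G(2) v point_in_zeros_iff[OF F(2)] point_in_zeros_iff[OF G(1)]
        by (auto simp: K poly_value.hom_mult)
    qed
    then show "p \<in> zariski closure_of (zeros F \<inter> U)"
      by (auto simp: in_closure_of topspace_zariski)
  qed
qed

section \<open>Partial morphisms\<close>

definition represents ::
    "('n::finite \<Rightarrow> 'n cpoly) \<Rightarrow> nat \<Rightarrow> 'n proj set \<Rightarrow> ('n proj \<rightharpoonup> 'n proj) \<Rightarrow> bool" where
  "represents G d U f \<longleftrightarrow> openin zariski U \<and> U \<subseteq> dom f \<and> (\<forall>i. homogeneous d (G i)) \<and>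
     (\<forall>v. v \<noteq> 0 \<and> point v \<in> U \<longrightarrow>
        tuple_value G v \<noteq> 0 \<and> f (point v) = Some (point (tuple_value G v)))"

lemma tuple_value_nth [simp]: "tuple_value G v $ i = poly_value (G i) v"
  by (simp add: tuple_value_def)

lemma tuple_value_Var: "tuple_value Var v = v"
  by (simp add: vec_eq_iff)

lemma partial_morphism_iff:
  "partial_morphism f \<longleftrightarrow> dom f \<noteq> {} \<and> (\<forall>p\<in>dom f. \<exists>U G d. p \<in> U \<and> represents G d U f)"
    (is "?l \<longleftrightarrow> ?r")
proof
  assume ?l
  then show ?r
    unfolding partial_morphism_def represents_def by (metis (no_types, lifting))
next
  assume r: ?r
  have "openin zariski (dom f)"
    by (subst openin_subopen) (use r in \<open>auto simp: represents_def\<close>)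
  with r show ?l
    unfolding partial_morphism_def represents_def by (metis (no_types, lifting))
qed

lemma partial_morphism_open: "partial_morphism f \<Longrightarrow> openin zariski (dom f)"
  by (simp add: partial_morphism_def)

lemma partial_morphism_representation:
  assumes "partial_morphism f" "p \<in> dom f"
  obtains U G d where "p \<in> U" "represents G d U f"
proof -
  have "\<exists>U G d. p \<in> U \<and> represents G d U f"
    using assms(1) unfolding partial_morphism_iff by (elim conjE bspec) (rule assms(2))
  then show ?thesis using that by blast
qed

lemma represents_agree:
  "represents G d U f \<Longrightarrow> (\<And>p. p \<in> U \<Longrightarrow> g p = f p) \<Longrightarrow> represents G d U g"
  by (force simp: represents_def)

lemma partial_morphism_Some: "partial_morphism Some"
proof -
  have "represents Var 1 UNIV Some"
    using homogeneous_Var by (auto simp: represents_def openin_zariski_UNIV tuple_value_Var)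
  then show ?thesis by (auto simp: partial_morphism_iff)
qed

lemma homogeneous_insertion:
  assumes "homogeneous e H" "\<And>i. homogeneous d (G i)"
  shows "homogeneous (e * d) (insertion Const G H)"
  unfolding insertion_def
proof (rule homogeneous_sum)
  fix m assume m: "m \<in> Poly_Mapping.keys H"
  have "homogeneous (\<Sum>i\<in>UNIV. Poly_Mapping.lookup m i * d) (\<Prod>i\<in>UNIV. G i ^ Poly_Mapping.lookup m i)"
    by (rule homogeneous_prod) (rule homogeneous_power, rule assms(2))
  moreover have "(\<Sum>i\<in>UNIV. Poly_Mapping.lookup m i * d) = e * d"
    using assms(1) m by (simp add: homogeneous_def sum_distrib_right[symmetric])
  ultimately show "homogeneous (e * d)
      (Const (Poly_Mapping.lookup H m) * (\<Prod>i\<in>UNIV. G i ^ Poly_Mapping.lookup m i))"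
    using homogeneous_mult[OF homogeneous_Const] by fastforce
qed

lemma poly_value_insertion: "poly_value (insertion Const G H) v = poly_value H (tuple_value G v)"
proof (rule cpoly_hom_eqI[of "\<lambda>H. poly_value (insertion Const G H) v" "\<lambda>H. poly_value H (tuple_value G v)"])
  show "ring_homomorphism (\<lambda>H. poly_value (insertion Const G H) v)"
    by (rule ring_homomorphism_comp[OF insertion_hom[OF Const_hom] poly_value_hom])
qed (simp_all add: poly_value_hom insertion_Const insertion_Var Const_hom)

lemma partial_morphism_comp:
  assumes f: "partial_morphism f" and g: "partial_morphism g" and ne: "dom (g \<circ>\<^sub>m f) \<noteq> {}"
  shows "partial_morphism (g \<circ>\<^sub>m f)"
  unfolding partial_morphism_iff
proof (intro conjI ballI)
  show "dom (g \<circ>\<^sub>m f) \<noteq> {}" by fact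
  fix p assume "p \<in> dom (g \<circ>\<^sub>m f)"
  then obtain y where "(g \<circ>\<^sub>m f) p = Some y" by blast
  then obtain q where q: "f p = Some q" "q \<in> dom g" unfolding map_comp_Some_iff by blast
  obtain U G d where U: "p \<in> U" "represents G d U f"
    using partial_morphism_representation[OF f] q(1) by blast
  obtain V H e where V: "q \<in> V" "represents H e V g"
    using partial_morphism_representation[OF g q(2)] .
  obtain K k where K: "homogeneous k K" "q \<notin> zeros K" "- zeros K \<subseteq> V"
    using V by (auto simp: represents_def openin_zariski_iff)
  \<comment> \<open>The pullback of \<open>K\<close>; its nonvanishing cuts out the part of
    \<open>U\<close> that \<open>f\<close> sends into the principal neighbourhood of
    \<open>q\<close>.\<close>
  define L where "L = insertion Const G K"
  have L: "homogeneous (k * d) L"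
    using homogeneous_insertion[OF K(1), of d G] U(2) by (simp add: L_def represents_def)
  have in_V: "f (point v) = Some (point (tuple_value G v))" "tuple_value G v \<noteq> 0"
      "point v \<in> - zeros L \<longleftrightarrow> point (tuple_value G v) \<in> - zeros K"
    if "v \<noteq> 0" "point v \<in> U" for v
    using that U(2) point_in_zeros_iff[OF L] point_in_zeros_iff[OF K(1)]
    by (auto simp: represents_def L_def poly_value_insertion)
  have "represents (\<lambda>i. insertion Const G (H i)) (e * d) (U \<inter> - zeros L) (g \<circ>\<^sub>m f)"
    unfolding represents_def
  proof (intro conjI allI impI)
    show "openin zariski (U \<inter> - zeros L)"
      using U(2) open_nonzeros[OF L] by (auto simp: represents_def)
    show "homogeneous (e * d) (insertion Const G (H i))" for i
      by (rule homogeneous_insertion) (use U(2) V(2) in \<open>auto simp: represents_def\<close>)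
    have eq: "tuple_value (\<lambda>i. insertion Const G (H i)) v = tuple_value H (tuple_value G v)" for v
      by (simp add: vec_eq_iff poly_value_insertion)
    have val: "tuple_value (\<lambda>i. insertion Const G (H i)) v \<noteq> 0 \<and>
        (g \<circ>\<^sub>m f) (point v) = Some (point (tuple_value (\<lambda>i. insertion Const G (H i)) v))"
      if "v \<noteq> 0 \<and> point v \<in> U \<inter> - zeros L" for v
    proof -
      have "point (tuple_value G v) \<in> V" "tuple_value G v \<noteq> 0"
        using that in_V[of v] K(3) by auto
      then show ?thesis
        using V(2) in_V(1)[of v] that unfolding represents_def eq by simp
    qed
    then show "tuple_value (\<lambda>i. insertion Const G (H i)) v \<noteq> 0"
      "(g \<circ>\<^sub>m f) (point v) = Some (point (tuple_value (\<lambda>i. insertion Const G (H i)) v))"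
      if "v \<noteq> 0 \<and> point v \<in> U \<inter> - zeros L" for v
      using that by blast+
    show "U \<inter> - zeros L \<subseteq> dom (g \<circ>\<^sub>m f)"
    proof
      fix x assume "x \<in> U \<inter> - zeros L"
      then show "x \<in> dom (g \<circ>\<^sub>m f)" using val by (cases x) blast
    qed
  qed
  moreover have "p \<in> U \<inter> - zeros L"
    using U(1) q(1) K(2) in_V by (cases p) auto
  ultimately show "\<exists>U G d. p \<in> U \<and> represents G d U (g \<circ>\<^sub>m f)" by (intro exI conjI)
qed

section \<open>Agreement and maximal extension of morphisms\<close>

lemma minors_vanish:
  assumes "v \<noteq> 0" "w \<noteq> 0" "point v = point w"
  shows "v $ i * w $ j = v $ j * w $ i"
proof -
  obtain c where "w = c *s v" using assms point_eq_iff[of v w] by blast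
  then show ?thesis by simp
qed

lemma point_eqI:
  assumes "v \<noteq> 0" "w \<noteq> 0" and minors: "\<And>i j. v $ i * w $ j = v $ j * w $ i"
  shows "point v = point w"
proof -
  obtain k where k: "v $ k \<noteq> 0" using assms(1) by (auto simp: vec_eq_iff)
  define c where "c = w $ k / v $ k"
  have w: "w = c *s v"
    using minors[of k] k by (simp add: vec_eq_iff c_def field_simps)
  then have "c \<noteq> 0" using assms(2) by auto
  then show ?thesis using w point_eq_iff assms(1,2) by blast
qed

text \<open>Nonempty open sets of projective space meet, so the minors vanish on a nonempty open set
  and are therefore zero as polynomials.\<close>

lemma representations_minors:
  fixes f g :: "4 proj \<rightharpoonup> 4 proj"
  assumes G: "represents G d U f" "U \<noteq> {}" and H: "represents H e V g" "V \<noteq> {}"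
    and N: "openin zariski N" "N \<noteq> {}" "\<And>p. p \<in> N \<Longrightarrow> f p = g p"
  shows "G i * H j = G j * H i"
proof -
  have UV: "openin zariski U" "openin zariski V" "openin zariski (U \<inter> V)"
    using G H by (auto simp: represents_def)
  have "G i * H j - G j * H i = 0"
  proof (rule vanishing_on_open)
    show "openin zariski (N \<inter> (U \<inter> V))" using UV N(1) by blast
    show "N \<inter> (U \<inter> V) \<noteq> {}"
      using open_meet[OF N(1) UV(3) N(2)] open_meet[OF UV(1,2) G(2) H(2)] by blast
    fix w :: "complex ^ 4" assume w: "w \<noteq> 0" "point w \<in> N \<inter> (U \<inter> V)"
    then have "tuple_value G w \<noteq> 0" "tuple_value H w \<noteq> 0"
        "point (tuple_value G w) = point (tuple_value H w)"
      using N(3)[of "point w"] G(1) H(1) by (auto simp: represents_def)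
    from minors_vanish[OF this, of i j]
    show "poly_value (G i * H j - G j * H i) w = 0"
      by (simp add: poly_value.hom_diff poly_value.hom_mult)
  qed
  then show ?thesis by simp
qed

text \<open>Projective space is separated: the minors are zero as polynomials, so they vanish at
  \<open>p\<close> as well, wherever the set \<open>N\<close> lies.\<close>

lemma partial_morphisms_agree:
  fixes f g :: "4 proj \<rightharpoonup> 4 proj"
  assumes f: "partial_morphism f" and g: "partial_morphism g"
    and N: "openin zariski N" "N \<noteq> {}" "\<And>p. p \<in> N \<Longrightarrow> f p = g p"
    and p: "f p = Some q" "g p = Some r"
  shows "q = r"
proof -
  obtain U G d where U: "p \<in> U" "represents G d U f"
    using partial_morphism_representation[OF f] p(1) by blast
  obtain V H e where V: "p \<in> V" "represents H e V g"
    using partial_morphism_representation[OF g] p(2) by blast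
  obtain v where v: "v \<noteq> 0" "p = point v" by (rule point_cases)
  have "G i * H j = G j * H i" for i j
    by (rule representations_minors[OF U(2) _ V(2) _ N]) (use U(1) V(1) in auto)
  then have "poly_value (G i) v * poly_value (H j) v = poly_value (G j) v * poly_value (H i) v" for i j
    by (metis poly_value.hom_mult)
  then have "point (tuple_value G v) = point (tuple_value H v)"
    by (intro point_eqI) (use U V v in \<open>auto simp: represents_def\<close>)
  then show ?thesis using U V v p by (auto simp: represents_def)
qed

text \<open>The maximal representative is the union of all extensions of \<open>f\<close>. Any two
  of them agree where both are defined, since they agree on the domain of \<open>f\<close>; hence
  the choice by \<open>SOME\<close> is harmless.\<close>

lemma rational_extension:
  fixes f :: "4 proj \<rightharpoonup> 4 proj"
  assumes f: "partial_morphism f"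
  obtains w where "rational_map w" "f \<subseteq>\<^sub>m w"
proof -
  define w where "w p = (if \<exists>g. partial_morphism g \<and> f \<subseteq>\<^sub>m g \<and> p \<in> dom g
    then (SOME g. partial_morphism g \<and> f \<subseteq>\<^sub>m g \<and> p \<in> dom g) p else None)" for p
  have w_eq: "w p = g p" if g: "partial_morphism g" "f \<subseteq>\<^sub>m g" "p \<in> dom g" for g p
  proof -
    define h where "h = (SOME g. partial_morphism g \<and> f \<subseteq>\<^sub>m g \<and> p \<in> dom g)"
    have h: "partial_morphism h" "f \<subseteq>\<^sub>m h" "p \<in> dom h"
      using someI[of "\<lambda>g. partial_morphism g \<and> f \<subseteq>\<^sub>m g \<and> p \<in> dom g" g] g unfolding h_def by blast+
    have "w p = h p" unfolding w_def h_def using g by auto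
    obtain q r where qr: "h p = Some q" "g p = Some r" using h(3) g(3) by blast
    have "q = r"
      by (rule partial_morphisms_agree[OF h(1) g(1) partial_morphism_open[OF f] _ _ qr])
        (use f h(2) g(2) in \<open>auto simp: partial_morphism_iff map_le_def\<close>)
    with qr \<open>w p = h p\<close> show ?thesis by simp
  qed
  have f_le: "f \<subseteq>\<^sub>m w"
    unfolding map_le_def using w_eq[OF f map_le_refl] by auto
  have pm: "partial_morphism w"
    unfolding partial_morphism_iff
  proof (intro conjI ballI)
    show "dom w \<noteq> {}" using f f_le by (force simp: partial_morphism_iff map_le_def)
    fix p assume "p \<in> dom w"
    then obtain g where g: "partial_morphism g" "f \<subseteq>\<^sub>m g" "p \<in> dom g"
      by (auto simp: w_def split: if_splits)
    obtain U G d where U: "p \<in> U" "represents G d U g"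
      using partial_morphism_representation[OF g(1,3)] .
    have "represents G d U w"
      by (rule represents_agree[OF U(2)]) (use U(2) w_eq[OF g(1,2)] in \<open>unfold represents_def, blast\<close>)
    with U(1) show "\<exists>U G d. p \<in> U \<and> represents G d U w" by blast
  qed
  have "g = w" if g: "partial_morphism g" "w \<subseteq>\<^sub>m g" for g
  proof (rule map_le_antisym)
    show "g \<subseteq>\<^sub>m w"
      unfolding map_le_def using w_eq[OF g(1) map_le_trans[OF f_le g(2)]] by auto
  qed (rule g(2))
  with pm f_le that show ?thesis unfolding rational_map_def by blast
qed

section \<open>Isomorphisms of open sets and birational maps\<close>

lemma inverse_isomorphismsD:
  assumes "inverse_isomorphisms f g"
  shows "partial_morphism f" "partial_morphism g" "f p = Some q \<longleftrightarrow> g q = Some p"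
  using assms by (auto simp: inverse_isomorphisms_def)

lemma inverse_isomorphisms_sym: "inverse_isomorphisms f g \<Longrightarrow> inverse_isomorphisms g f"
  by (auto simp: inverse_isomorphisms_def)

lemma inverse_isomorphisms_comp:
  assumes "inverse_isomorphisms f g" "inverse_isomorphisms f' g'" "dom (f' \<circ>\<^sub>m f) \<noteq> {}"
  shows "inverse_isomorphisms (f' \<circ>\<^sub>m f) (g \<circ>\<^sub>m g')"
proof -
  have iff: "(f' \<circ>\<^sub>m f) p = Some q \<longleftrightarrow> (g \<circ>\<^sub>m g') q = Some p" for p q
    unfolding map_comp_Some_iff using assms(1,2) by (auto simp: inverse_isomorphisms_def)
  then have "dom (g \<circ>\<^sub>m g') \<noteq> {}" using assms(3) by blast
  with iff assms show ?thesis
    unfolding inverse_isomorphisms_def by (intro conjI allI partial_morphism_comp) auto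
qed

text \<open>The composite of the extensions is the identity on \<open>dom f\<close>, hence wherever
  it is defined.\<close>

lemma composes_to_identityI:
  fixes w w' :: "4 proj \<rightharpoonup> 4 proj"
  assumes "inverse_isomorphisms f g" "partial_morphism w" "partial_morphism w'" "f \<subseteq>\<^sub>m w" "g \<subseteq>\<^sub>m w'"
  shows "composes_to_identity w' w"
proof -
  note fg = inverse_isomorphismsD[OF assms(1)]
  have on_dom: "(w' \<circ>\<^sub>m w) p = Some p" if p: "p \<in> dom f" for p
  proof -
    obtain q where q: "f p = Some q" using p by blast
    then have "g q = Some p" using fg(3) by blast
    then show ?thesis using q assms(4,5) unfolding map_comp_Some_iff map_le_def by force
  qed
  have ne: "dom f \<noteq> {}" using fg(1) by (simp add: partial_morphism_iff)
  then have ne': "dom (w' \<circ>\<^sub>m w) \<noteq> {}" using on_dom by blast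
  have pm: "partial_morphism (w' \<circ>\<^sub>m w)" by (rule partial_morphism_comp[OF assms(2,3) ne'])
  have "(w' \<circ>\<^sub>m w) p = Some p" if p: "p \<in> dom (w' \<circ>\<^sub>m w)" for p
  proof -
    obtain q where q: "(w' \<circ>\<^sub>m w) p = Some q" using p by blast
    have "q = p"
      by (rule partial_morphisms_agree[OF pm partial_morphism_Some partial_morphism_open[OF fg(1)] ne on_dom q])
        simp_all
    with q show ?thesis by simp
  qed
  with ne' show ?thesis unfolding composes_to_identity_def map_le_def by (intro conjI ballI)
qed

lemma birational_extension:
  fixes f g :: "4 proj \<rightharpoonup> 4 proj"
  assumes fg: "inverse_isomorphisms f g"
  obtains w where "birational w" "f \<subseteq>\<^sub>m w"
proof -
  note pm = inverse_isomorphismsD(1,2)[OF fg]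
  obtain w where w: "rational_map w" "f \<subseteq>\<^sub>m w" using rational_extension[OF pm(1)] .
  obtain w' where w': "rational_map w'" "g \<subseteq>\<^sub>m w'" using rational_extension[OF pm(2)] .
  have pm': "partial_morphism w" "partial_morphism w'" using w(1) w'(1) by (simp_all add: rational_map_def)
  have "composes_to_identity w' w"
    by (rule composes_to_identityI[OF fg pm' w(2) w'(2)])
  moreover have "composes_to_identity w w'"
    by (rule composes_to_identityI[OF inverse_isomorphisms_sym[OF fg] pm'(2,1) w'(2) w(2)])
  ultimately have "birational w" using w(1) w'(1) unfolding birational_def by blast
  with w(2) that show ?thesis by blast
qed

lemma inverse_isomorphisms_Some: "inverse_isomorphisms Some Some"
  by (auto simp: inverse_isomorphisms_def partial_morphism_Some)

lemma rational_map_Some: "rational_map Some"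
  unfolding rational_map_def
proof (intro conjI allI impI partial_morphism_Some)
  fix g :: "'a proj \<rightharpoonup> 'a proj"
  assume "partial_morphism g \<and> Some \<subseteq>\<^sub>m g"
  then show "g = Some" by (auto simp: map_le_def fun_eq_iff)
qed

text \<open>Bounds the minimal Cremona degree by the degree of the hypersurface itself.\<close>

lemma cremona_equivalent_refl:
  assumes "homogeneous d F" "zeros F \<noteq> {}"
  shows "cremona_equivalent (zeros F) (zeros F)"
  unfolding cremona_equivalent_def
proof (intro exI conjI)
  show "birational Some"
    unfolding birational_def composes_to_identity_def
    using rational_map_Some by (auto simp: map_comp_def fun_eq_iff intro!: exI[of _ Some])
  show "isomorphism_at_generic_point Some (zeros F)"
    unfolding isomorphism_at_generic_point_def
    by (intro exI[of _ UNIV] exI[of _ Some])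
      (use assms(2) inverse_isomorphisms_Some in \<open>auto simp: openin_zariski_UNIV restrict_map_def\<close>)
  show "proper_image Some (zeros F) = zeros F"
    unfolding proper_image_def using closedin_zeros[OF assms(1)] by (simp add: closure_of_eq)
qed

section \<open>Restriction of forms to lines\<close>

text \<open>The coefficient is taken at a bound for the degree rather than at the degree, because a
  form restricted to a line may drop in degree.\<close>

lemma top_coeff_mult:
  fixes q r :: "'a::idom poly"
  assumes "degree q \<le> a" "degree r \<le> b"
  shows "degree (q * r) \<le> a + b" "coeff (q * r) (a + b) = coeff q a * coeff r b"
proof -
  show le: "degree (q * r) \<le> a + b"
    using degree_mult_le[of q r] assms by linarith
  show "coeff (q * r) (a + b) = coeff q a * coeff r b"
  proof (cases "degree q = a \<and> degree r = b")
    case True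
    then show ?thesis using coeff_mult_degree_sum[of q r] by simp
  next
    case False
    then have "degree q + degree r < a + b" using assms by linarith
    then have "degree (q * r) < a + b" using degree_mult_le[of q r] by linarith
    moreover have "coeff q a * coeff r b = 0"
      using False assms by (auto simp: coeff_eq_0)
    ultimately show ?thesis by (simp add: coeff_eq_0)
  qed
qed

lemma top_coeff_power:
  fixes q :: "'a::idom poly"
  assumes "degree q \<le> a"
  shows "degree (q ^ n) \<le> n * a \<and> coeff (q ^ n) (n * a) = coeff q a ^ n"
  by (induction n) (use top_coeff_mult[OF assms] in auto)

lemma top_coeff_prod:
  fixes q :: "'i \<Rightarrow> 'a::idom poly"
  assumes "\<And>i. i \<in> I \<Longrightarrow> degree (q i) \<le> a i" "finite I"
  shows "degree (\<Prod>i\<in>I. q i) \<le> (\<Sum>i\<in>I. a i) \<and>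
    coeff (\<Prod>i\<in>I. q i) (\<Sum>i\<in>I. a i) = (\<Prod>i\<in>I. coeff (q i) (a i))"
  using assms(2,1) by (induction I) (auto simp: top_coeff_mult)

lemma form_on_line:
  assumes F: "homogeneous d F"
  obtains q where "degree q \<le> d" "coeff q d = poly_value F p"
    and "\<And>z. poly q z = poly_value F (x + z *s p)"
proof -
  define l where "l i = [:x $ i, p $ i:]" for i
  define q where "q = insertion (\<lambda>c. [:c:]) l F"
  have monomial: "degree ([:c:] * (\<Prod>i\<in>UNIV. l i ^ Poly_Mapping.lookup m i)) \<le> d \<and>
      coeff ([:c:] * (\<Prod>i\<in>UNIV. l i ^ Poly_Mapping.lookup m i)) d
        = c * (\<Prod>i\<in>UNIV. (p $ i) ^ Poly_Mapping.lookup m i)"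
    if m: "m \<in> Poly_Mapping.keys F" for c m
  proof -
    have l: "degree (l i) \<le> 1" "coeff (l i) 1 = p $ i" for i
      by (simp_all add: l_def)
    have pw: "degree (l i ^ n) \<le> n" "coeff (l i ^ n) n = (p $ i) ^ n" for i n
      using top_coeff_power[OF l(1)[of i], of n] l(2) by simp_all
    have "(\<Sum>i\<in>UNIV. Poly_Mapping.lookup m i) = d"
      using F m by (simp add: homogeneous_def)
    then have "degree (\<Prod>i\<in>UNIV. l i ^ Poly_Mapping.lookup m i) \<le> d \<and>
        coeff (\<Prod>i\<in>UNIV. l i ^ Poly_Mapping.lookup m i) d
          = (\<Prod>i\<in>UNIV. (p $ i) ^ Poly_Mapping.lookup m i)"
      using top_coeff_prod[of UNIV "\<lambda>i. l i ^ Poly_Mapping.lookup m i" "Poly_Mapping.lookup m"] pw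
      by simp
    then show ?thesis using degree_smult_le le_trans by fastforce
  qed
  have "degree q \<le> d"
    unfolding q_def insertion_def by (rule degree_sum_le) (use monomial in auto)
  moreover have "coeff q d = poly_value F p"
    unfolding q_def insertion_def coeff_sum poly_value_def
    by (rule sum.cong) (use monomial in auto)
  moreover have "poly q z = poly_value F (x + z *s p)" for z
    unfolding q_def
  proof (rule cpoly_hom_eqI[of "\<lambda>F. poly (insertion (\<lambda>c. [:c:]) l F) z" "\<lambda>F. poly_value F (x + z *s p)"])
    show "ring_homomorphism (\<lambda>F. poly (insertion (\<lambda>c. [:c:]) l F) z)"
      by (rule ring_homomorphism_comp[OF insertion_hom[OF ring_homomorphism_const_poly]
          ring_homomorphism_poly])
  qed (simp_all add: poly_value_hom insertion_Const insertion_Var ring_homomorphism_const_poly l_def)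
  ultimately show ?thesis using that by blast
qed

lemma form_zero_on_line:
  assumes F: "homogeneous d F" "d > 0"
  obtains v where "poly_value F v = 0" "v = y \<or> (\<exists>z. v = x + z *s y)"
proof (cases "poly_value F y = 0")
  case False
  obtain q where q: "degree q \<le> d" "coeff q d = poly_value F y"
    "\<And>z. poly q z = poly_value F (x + z *s y)"
    using form_on_line[OF F(1)] by metis
  have "degree q = d" using q(1,2) False le_degree[of q d] by simp
  then have "\<not> constant (poly q)" using F(2) constant_degree[of q] by simp
  then obtain z where "poly q z = 0" using fundamental_theorem_of_algebra by blast
  then show ?thesis using q(3) that by metis
qed (use that in blast)

text \<open>As \<open>F\<close> vanishes at \<open>p\<close>, the restriction to the line has no
  cubic term. Its coefficients are interpolated from the values at 0, 1 and -1, which shows that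
  they depend polynomially on \<open>x\<close>.\<close>

lemma form_expansion:
  assumes F: "homogeneous d F" "d \<le> 3" and p: "poly_value F p = 0"
  shows "poly_value F (x + z *s p) = poly_value F x
    + (poly_value F (x + p) - poly_value F (x - p)) / 2 * z
    + (poly_value F (x + p) + poly_value F (x - p) - 2 * poly_value F x) / 2 * z\<^sup>2"
proof -
  obtain q where q: "degree q \<le> d" "coeff q d = poly_value F p"
    "\<And>z. poly q z = poly_value F (x + z *s p)"
    using form_on_line[OF F(1)] by metis
  have "degree q \<le> 2"
  proof (cases "degree q = d \<and> d = 3")
    case True
    then show ?thesis using q(2) p by (metis leading_coeff_0_iff degree_0 zero_le)
  qed (use q(1) F(2) in auto)
  then have "q = [:coeff q 0, coeff q 1, coeff q 2:]"
    by (intro poly_eqI) (auto simp: coeff_pCons coeff_eq_0 numeral_2_eq_2 split: nat.splits)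
  then obtain a b c where q': "q = [:a, b, c:]" by blast
  have val: "poly_value F (x + z *s p) = a + b * z + c * z\<^sup>2" for z
    unfolding q(3)[symmetric] q' by (simp add: power2_eq_square algebra_simps)
  have eqs: "poly_value F x = a" "poly_value F (x + p) = a + b + c" "poly_value F (x - p) = a - b + c"
    using val[of 0] val[of 1] val[of "-1"] by simp_all
  show ?thesis unfolding val eqs by simp
qed


section \<open>Maps given by forms\<close>

text \<open>The domain is prescribed by \<open>K\<close> and may be smaller than the set where
  \<open>G\<close> has no common zero. The choice of coordinates does not matter when
  \<open>G\<close> consists of forms of one degree.\<close>

definition form_map :: "'n::finite cpoly \<Rightarrow> ('n \<Rightarrow> 'n cpoly) \<Rightarrow> 'n proj \<rightharpoonup> 'n proj" where
  "form_map K G p = (if p \<in> zeros K then None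
     else Some (point (tuple_value G (SOME v. v \<noteq> 0 \<and> p = point v))))"

lemma tuple_value_scale:
  "(\<And>i. homogeneous e (G i)) \<Longrightarrow> tuple_value G (c *s v) = c ^ e *s tuple_value G v"
  by (simp add: vec_eq_iff poly_value_scale)

lemma form_map_point:
  assumes "homogeneous k K" "\<And>i. homogeneous e (G i)" "v \<noteq> 0" "poly_value K v \<noteq> 0"
    and "tuple_value G v \<noteq> 0"
  shows "form_map K G (point v) = Some (point (tuple_value G v))"
proof -
  define w where "w = (SOME w. w \<noteq> 0 \<and> point v = point w)"
  have w: "w \<noteq> 0" "point v = point w"
    using someI[of "\<lambda>w. w \<noteq> 0 \<and> point v = point w" v] assms(3) unfolding w_def by auto
  then obtain c where c: "c \<noteq> 0" "w = c *s v" using point_eq_iff[OF assms(3) w(1)] by blast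
  have "point (tuple_value G w) = point (tuple_value G v)"
    unfolding c(2) tuple_value_scale[OF assms(2)] by (rule point_scale) (use c assms(5) in auto)
  then show ?thesis
    using point_in_zeros_iff[OF assms(1,3)] assms(4) unfolding form_map_def w_def by simp
qed

lemma dom_form_map: "dom (form_map K G) = - zeros K"
  by (auto simp: form_map_def split: if_splits)

lemma partial_morphism_form_map:
  assumes K: "homogeneous k K" "zeros K \<noteq> UNIV" and G: "\<And>i. homogeneous e (G i)"
    and nz: "\<And>v. v \<noteq> 0 \<Longrightarrow> poly_value K v \<noteq> 0 \<Longrightarrow> tuple_value G v \<noteq> 0"
  shows "partial_morphism (form_map K G)"
proof -
  have "represents G e (- zeros K) (form_map K G)"
    unfolding represents_def
  proof (intro conjI allI impI open_nonzeros[OF K(1)] G)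
    show "- zeros K \<subseteq> dom (form_map K G)" by (simp add: dom_form_map)
    fix v assume v: "v \<noteq> 0 \<and> point v \<in> - zeros K"
    then have Kv: "poly_value K v \<noteq> 0" using point_in_zeros_iff[OF K(1), of v] by simp
    show G0: "tuple_value G v \<noteq> 0" by (rule nz) (use v Kv in auto)
    show "form_map K G (point v) = Some (point (tuple_value G v))"
      by (rule form_map_point[OF K(1) G _ Kv G0]) (use v in simp)
  qed
  then show ?thesis
    unfolding partial_morphism_iff dom_form_map using K(2) by blast
qed

lemma inverse_isomorphisms_form_map:
  assumes K: "homogeneous k K" "homogeneous k' K'" "zeros K \<noteq> UNIV"
    and G: "\<And>i. homogeneous e (G i)" "\<And>i. homogeneous e' (G' i)"
    and there: "\<And>v. v \<noteq> 0 \<Longrightarrow> poly_value K v \<noteq> 0 \<Longrightarrow> tuple_value G v \<noteq> 0 \<and>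
      poly_value K' (tuple_value G v) \<noteq> 0 \<and> (\<exists>c. c \<noteq> 0 \<and> tuple_value G' (tuple_value G v) = c *s v)"
    and there_inv: "\<And>v. v \<noteq> 0 \<Longrightarrow> poly_value K' v \<noteq> 0 \<Longrightarrow> tuple_value G' v \<noteq> 0 \<and>
      poly_value K (tuple_value G' v) \<noteq> 0 \<and> (\<exists>c. c \<noteq> 0 \<and> tuple_value G (tuple_value G' v) = c *s v)"
  shows "inverse_isomorphisms (form_map K G) (form_map K' G')"
proof -
  \<comment> \<open>Stated for arbitrary data, so that it can be applied in both directions.\<close>
  have inv: "form_map K' G' q = Some p"
    if K: "homogeneous k K" "homogeneous k' K'"
      and G: "\<And>i. homogeneous e (G i)" "\<And>i. homogeneous e' (G' i)"
      and there: "\<And>v. v \<noteq> 0 \<Longrightarrow> poly_value K v \<noteq> 0 \<Longrightarrow> tuple_value G v \<noteq> 0 \<and>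
        poly_value K' (tuple_value G v) \<noteq> 0 \<and> (\<exists>c. c \<noteq> 0 \<and> tuple_value G' (tuple_value G v) = c *s v)"
      and pq: "form_map K G p = Some q" for K K' k k' G G' e e' p q
  proof -
    obtain v where v: "v \<noteq> 0" "p = point v" by (rule point_cases)
    have "p \<notin> zeros K" using pq by (auto simp: form_map_def)
    then have Kv: "poly_value K v \<noteq> 0" using point_in_zeros_iff[OF K(1), of v] v by simp
    let ?w = "tuple_value G v"
    from there[OF v(1) Kv] obtain c where w: "?w \<noteq> 0" "poly_value K' ?w \<noteq> 0"
      and c: "c \<noteq> 0" "tuple_value G' ?w = c *s v" by blast
    have q: "q = point ?w" using form_map_point[OF K(1) G(1) v(1) Kv w(1)] pq v(2) by simp
    have "tuple_value G' ?w \<noteq> 0" using c v(1) by simp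
    from form_map_point[OF K(2) G(2) w this] show ?thesis
      unfolding q v(2) c(2) point_scale[OF c(1) v(1)] .
  qed
  obtain p where "p \<notin> zeros K" using K(3) by blast
  then obtain q where pq: "form_map K G p = Some q" by (auto simp: form_map_def)
  have "form_map K' G' q = Some p" by (rule inv[OF K(1,2) G _ pq]) (rule there)
  then have K': "zeros K' \<noteq> UNIV" by (auto simp: form_map_def split: if_splits)
  show ?thesis
    unfolding inverse_isomorphisms_def
  proof (intro conjI allI iffI)
    show "partial_morphism (form_map K G)"
      by (rule partial_morphism_form_map[OF K(1,3) G(1)]) (use there in blast)
    show "partial_morphism (form_map K' G')"
      by (rule partial_morphism_form_map[OF K(2) K' G(2)]) (use there_inv in blast)
    show "form_map K' G' q = Some p" if "form_map K G p = Some q" for p q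
      by (rule inv[OF K(1,2) G _ that]) (rule there)
    show "form_map K G p = Some q" if "form_map K' G' q = Some p" for p q
      by (rule inv[OF K(2,1) G(2,1) _ that]) (rule there_inv)
  qed
qed

section \<open>A de Jonquieres map fixing a surface pointwise\<close>

text \<open>On each line through \<open>p\<close> with coordinate \<open>z\<close> the form \<open>F\<close> is \<open>C + B z + A z\<^sup>2\<close>, where
  \<open>C = F\<close> at the base point \<open>x\<close> of the line. The map restricts there to the Moebius transformation with matrix
  \<open>(\<alpha>, - C; A, \<alpha> + B)\<close>, whose fixed points are the zeros of \<open>F\<close>.\<close>

locale de_jonquieres =
  fixes F A B \<alpha> :: "complex ^ 'n::finite \<Rightarrow> complex" and p :: "complex ^ 'n" and k :: 'n and d :: nat
  assumes expansion: "F (x + z *s p) = F x + B x * z + A x * z\<^sup>2"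
    and F_scale: "c \<noteq> 0 \<Longrightarrow> F (c *s x) = c ^ d * F x"
    and B_scale: "c \<noteq> 0 \<Longrightarrow> c * B (c *s x) = c ^ d * B x"
    and A_scale: "c \<noteq> 0 \<Longrightarrow> c\<^sup>2 * A (c *s x) = c ^ d * A x"
    and \<alpha>_scale: "c \<noteq> 0 \<Longrightarrow> c * \<alpha> (c *s x) = c ^ d * \<alpha> x"
    and p_k: "p $ k = 1"
begin

text \<open>The projection from \<open>p\<close> onto the hyperplane where coordinate
  \<open>k\<close> vanishes; this uses that \<open>p $ k\<close> is 1.\<close>

definition base :: "complex ^ 'n \<Rightarrow> complex ^ 'n" where
  "base v = v - (v $ k) *s p"

text \<open>The denominator of the Moebius transformation, at the coordinate \<open>v $ k\<close> on
  the line through \<open>p\<close>.\<close>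

definition s :: "complex ^ 'n \<Rightarrow> complex" where
  "s v = A (base v) * v $ k + \<alpha> (base v) + B (base v)"

text \<open>The denominator of the inverse transformation, read off from the adjugate
  matrix.\<close>

definition s' :: "complex ^ 'n \<Rightarrow> complex" where
  "s' v = \<alpha> (base v) - A (base v) * v $ k"

text \<open>The determinant of the Moebius matrix.\<close>

definition \<Delta> :: "complex ^ 'n \<Rightarrow> complex" where
  "\<Delta> v = (\<alpha> (base v))\<^sup>2 + \<alpha> (base v) * B (base v) + A (base v) * F (base v)"

text \<open>The transformation with its denominator cleared. In this form it is evident that zeros
  of \<open>F\<close> stay fixed; \<open>jmap_eq\<close> gives the Moebius form.\<close>

definition jmap :: "complex ^ 'n \<Rightarrow> complex ^ 'n" where
  "jmap v = s v *s v - F v *s p"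

definition jinv :: "complex ^ 'n \<Rightarrow> complex ^ 'n" where
  "jinv v = s' v *s v + F v *s p"

lemma decompose: "v = base v + (v $ k) *s p"
  by (simp add: base_def)

lemma base_scale: "base (c *s v) = c *s base v"
  by (simp add: base_def vec_eq_iff algebra_simps)

lemma base_combine: "base (c *s base v + t *s p) = c *s base v" "(c *s base v + t *s p) $ k = t"
  by (simp_all add: base_def vec_eq_iff p_k)

lemma F_decompose: "F v = F (base v) + B (base v) * v $ k + A (base v) * (v $ k)\<^sup>2"
  using expansion[of "base v" "v $ k"] decompose[of v] by simp

lemma s_scale: "c \<noteq> 0 \<Longrightarrow> c * s (c *s v) = c ^ d * s v"
  using A_scale[of c "base v"] B_scale[of c "base v"] \<alpha>_scale[of c "base v"]
  unfolding s_def base_scale by (simp add: power2_eq_square algebra_simps)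

lemma s'_scale: "c \<noteq> 0 \<Longrightarrow> c * s' (c *s v) = c ^ d * s' v"
  using A_scale[of c "base v"] \<alpha>_scale[of c "base v"]
  unfolding s'_def base_scale by (simp add: power2_eq_square algebra_simps)

lemma \<Delta>_base: "\<Delta> (base v) = \<Delta> v"
  using base_combine(1)[of 1 v 0] by (simp add: \<Delta>_def)

lemma \<Delta>_scale:
  assumes "c \<noteq> 0"
  shows "c\<^sup>2 * \<Delta> (c *s v) = (c ^ d)\<^sup>2 * \<Delta> v"
proof -
  let ?x = "base v"
  have "c\<^sup>2 * \<Delta> (c *s v) = (c * \<alpha> (c *s ?x))\<^sup>2 + (c * \<alpha> (c *s ?x)) * (c * B (c *s ?x))
      + (c\<^sup>2 * A (c *s ?x)) * F (c *s ?x)"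
    unfolding \<Delta>_def base_scale by (simp add: algebra_simps power2_eq_square)
  also have "\<dots> = (c ^ d)\<^sup>2 * \<Delta> v"
    unfolding A_scale[OF assms] B_scale[OF assms] \<alpha>_scale[OF assms] F_scale[OF assms] \<Delta>_def
    by (simp add: algebra_simps power2_eq_square)
  finally show ?thesis .
qed

lemma jmap_eq:
  "jmap v = s v *s base v + (\<alpha> (base v) * v $ k - F (base v)) *s p"
proof -
  have "jmap v = s v *s base v + (s v * v $ k - F v) *s p"
    unfolding jmap_def by (subst (2) decompose) (simp add: vec_eq_iff algebra_simps)
  moreover have "s v * v $ k - F v = \<alpha> (base v) * v $ k - F (base v)"
    unfolding s_def F_decompose[of v] by (simp add: algebra_simps power2_eq_square)
  ultimately show ?thesis by simp
qed

lemma jinv_eq: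
  "jinv v = s' v *s base v + ((\<alpha> (base v) + B (base v)) * v $ k + F (base v)) *s p"
proof -
  have "jinv v = s' v *s base v + (s' v * v $ k + F v) *s p"
    unfolding jinv_def by (subst (2) decompose) (simp add: vec_eq_iff algebra_simps)
  moreover have "s' v * v $ k + F v = (\<alpha> (base v) + B (base v)) * v $ k + F (base v)"
    unfolding s'_def F_decompose[of v] by (simp add: algebra_simps power2_eq_square)
  ultimately show ?thesis by simp
qed

lemma scale_components:
  assumes "c \<noteq> 0"
  shows "c\<^sup>2 * F (c *s base v + t *s p) =
    c ^ d * (c\<^sup>2 * F (base v) + c * B (base v) * t + A (base v) * t\<^sup>2)"
proof -
  have "c\<^sup>2 * F (c *s base v + t *s p) = c\<^sup>2 * F (c *s base v) + c * (c * B (c *s base v)) * t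
      + (c\<^sup>2 * A (c *s base v)) * t\<^sup>2"
    unfolding expansion by (simp add: algebra_simps power2_eq_square)
  also have "\<dots> = c ^ d * (c\<^sup>2 * F (base v) + c * B (base v) * t + A (base v) * t\<^sup>2)"
    unfolding A_scale[OF assms] B_scale[OF assms] F_scale[OF assms] by (simp add: algebra_simps)
  finally show ?thesis .
qed

text \<open>The matrix times its adjugate is \<open>\<Delta>\<close> times the identity. The powers
  of \<open>s v\<close> come from rescaling the base point and are kept on both sides to avoid
  division.\<close>

lemma s'_jmap:
  assumes "s v \<noteq> 0"
  shows "(s v)\<^sup>2 * s' (jmap v) = s v ^ d * \<Delta> v"
proof -
  let ?c = "s v" and ?x = "base v" and ?t = "\<alpha> (base v) * v $ k - F (base v)"
  have "?c\<^sup>2 * s' (jmap v) = ?c * (?c * \<alpha> (?c *s ?x)) - ?c\<^sup>2 * A (?c *s ?x) * ?t"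
    unfolding s'_def jmap_eq base_combine by (simp add: algebra_simps power2_eq_square)
  also have "\<dots> = ?c ^ d * (?c * \<alpha> ?x - A ?x * ?t)"
    unfolding A_scale[OF assms] \<alpha>_scale[OF assms] by (simp add: algebra_simps)
  also have "?c * \<alpha> ?x - A ?x * ?t = \<Delta> v"
    unfolding s_def \<Delta>_def by (simp add: algebra_simps power2_eq_square)
  finally show ?thesis .
qed

lemma s_jinv:
  assumes "s' v \<noteq> 0"
  shows "(s' v)\<^sup>2 * s (jinv v) = s' v ^ d * \<Delta> v"
proof -
  let ?c = "s' v" and ?x = "base v" and ?t = "(\<alpha> (base v) + B (base v)) * v $ k + F (base v)"
  have "?c\<^sup>2 * s (jinv v) = ?c\<^sup>2 * A (?c *s ?x) * ?t + ?c * (?c * \<alpha> (?c *s ?x)) + ?c * (?c * B (?c *s ?x))"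
    unfolding s_def jinv_eq base_combine by (simp add: algebra_simps power2_eq_square)
  also have "\<dots> = ?c ^ d * (A ?x * ?t + ?c * \<alpha> ?x + ?c * B ?x)"
    unfolding A_scale[OF assms] B_scale[OF assms] \<alpha>_scale[OF assms] by (simp add: algebra_simps)
  also have "A ?x * ?t + ?c * \<alpha> ?x + ?c * B ?x = \<Delta> v"
    unfolding s'_def \<Delta>_def by (simp add: algebra_simps power2_eq_square)
  finally show ?thesis .
qed

text \<open>The components along the base point agree at once; the component along \<open>p\<close>
  is the other half of the matrix identity behind \<open>s'_jmap\<close>.\<close>

lemma jinv_jmap:
  assumes "s v \<noteq> 0"
  shows "jinv (jmap v) = (s' (jmap v) * s v) *s v"
proof -
  let ?c = "s v" and ?x = "base v" and ?t = "\<alpha> (base v) * v $ k - F (base v)"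
  have "?c\<^sup>2 * (s' (jmap v) * ?t + F (jmap v)) = ?c\<^sup>2 * (s' (jmap v) * s v * v $ k)"
  proof -
    have "?c\<^sup>2 * (s' (jmap v) * ?t + F (jmap v))
        = (?c\<^sup>2 * s' (jmap v)) * ?t + ?c\<^sup>2 * F (?c *s ?x + ?t *s p)"
      unfolding jmap_eq[symmetric] by (simp add: algebra_simps)
    also have "\<dots> = ?c ^ d * (\<Delta> v * ?t + (?c\<^sup>2 * F ?x + ?c * B ?x * ?t + A ?x * ?t\<^sup>2))"
      unfolding s'_jmap[OF assms] scale_components[OF assms] by (simp add: algebra_simps)
    also have "\<Delta> v * ?t + (?c\<^sup>2 * F ?x + ?c * B ?x * ?t + A ?x * ?t\<^sup>2) = \<Delta> v * s v * v $ k"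
      unfolding s_def \<Delta>_def by (simp add: algebra_simps power2_eq_square)
    also have "?c ^ d * (\<Delta> v * s v * v $ k) = (?c\<^sup>2 * s' (jmap v)) * s v * v $ k"
      unfolding s'_jmap[OF assms] by simp
    finally show ?thesis by (simp add: algebra_simps)
  qed
  then have z: "s' (jmap v) * ?t + F (jmap v) = s' (jmap v) * s v * v $ k"
    using assms by simp
  have "jinv (jmap v) = (s' (jmap v) * s v) *s ?x + (s' (jmap v) * ?t + F (jmap v)) *s p"
    unfolding jinv_def by (subst (2) jmap_eq) (simp add: vec_eq_iff algebra_simps)
  also have "\<dots> = (s' (jmap v) * s v) *s (?x + (v $ k) *s p)"
    unfolding z by (simp add: vec_eq_iff algebra_simps)
  finally show ?thesis using decompose[of v] by simp
qed

lemma jmap_jinv: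
  assumes "s' v \<noteq> 0"
  shows "jmap (jinv v) = (s (jinv v) * s' v) *s v"
proof -
  let ?c = "s' v" and ?x = "base v" and ?t = "(\<alpha> (base v) + B (base v)) * v $ k + F (base v)"
  have "?c\<^sup>2 * (s (jinv v) * ?t - F (jinv v)) = ?c\<^sup>2 * (s (jinv v) * s' v * v $ k)"
  proof -
    have "?c\<^sup>2 * (s (jinv v) * ?t - F (jinv v))
        = (?c\<^sup>2 * s (jinv v)) * ?t - ?c\<^sup>2 * F (?c *s ?x + ?t *s p)"
      unfolding jinv_eq[symmetric] by (simp add: algebra_simps)
    also have "\<dots> = ?c ^ d * (\<Delta> v * ?t - (?c\<^sup>2 * F ?x + ?c * B ?x * ?t + A ?x * ?t\<^sup>2))"
      unfolding s_jinv[OF assms] scale_components[OF assms] by (simp add: algebra_simps)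
    also have "\<Delta> v * ?t - (?c\<^sup>2 * F ?x + ?c * B ?x * ?t + A ?x * ?t\<^sup>2) = \<Delta> v * s' v * v $ k"
      unfolding s'_def \<Delta>_def by (simp add: algebra_simps power2_eq_square)
    also have "?c ^ d * (\<Delta> v * s' v * v $ k) = (?c\<^sup>2 * s (jinv v)) * s' v * v $ k"
      unfolding s_jinv[OF assms] by simp
    finally show ?thesis by (simp add: algebra_simps)
  qed
  then have z: "s (jinv v) * ?t - F (jinv v) = s (jinv v) * s' v * v $ k"
    using assms by simp
  have "jmap (jinv v) = (s (jinv v) * s' v) *s ?x + (s (jinv v) * ?t - F (jinv v)) *s p"
    unfolding jmap_def by (subst (2) jinv_eq) (simp add: vec_eq_iff algebra_simps)
  also have "\<dots> = (s (jinv v) * s' v) *s (?x + (v $ k) *s p)"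
    unfolding z by (simp add: vec_eq_iff algebra_simps)
  finally show ?thesis using decompose[of v] by simp
qed

text \<open>\<open>\<Delta>\<close> depends only on the line through \<open>p\<close>, and
  \<open>jmap\<close> merely rescales the base point of that line.\<close>

lemma jmap_regular:
  assumes "s v \<noteq> 0" "\<Delta> v \<noteq> 0"
  shows "s' (jmap v) \<noteq> 0" "\<Delta> (jmap v) \<noteq> 0"
proof -
  show "s' (jmap v) \<noteq> 0" using s'_jmap[OF assms(1)] assms by auto
  have "\<Delta> (jmap v) = \<Delta> (s v *s v)"
    using \<Delta>_base[of "jmap v"] \<Delta>_base[of "s v *s v"] unfolding jmap_eq base_combine base_scale by simp
  then show "\<Delta> (jmap v) \<noteq> 0" using \<Delta>_scale[OF assms(1), of v] assms by auto
qed

lemma jinv_regular: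
  assumes "s' v \<noteq> 0" "\<Delta> v \<noteq> 0"
  shows "s (jinv v) \<noteq> 0" "\<Delta> (jinv v) \<noteq> 0"
proof -
  show "s (jinv v) \<noteq> 0" using s_jinv[OF assms(1)] assms by auto
  have "\<Delta> (jinv v) = \<Delta> (s' v *s v)"
    using \<Delta>_base[of "jinv v"] \<Delta>_base[of "s' v *s v"] unfolding jinv_eq base_combine base_scale by simp
  then show "\<Delta> (jinv v) \<noteq> 0" using \<Delta>_scale[OF assms(1), of v] assms by auto
qed

end

section \<open>Forms recovered from functions\<close>

definition polynomial_function :: "(complex ^ 'n::finite \<Rightarrow> complex) \<Rightarrow> bool" where
  "polynomial_function f \<longleftrightarrow> (\<exists>P. \<forall>v. poly_value P v = f v)"

lemma polynomial_function_const: "polynomial_function (\<lambda>v. c)"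
  unfolding polynomial_function_def by (rule exI[of _ "Const c"]) simp

lemma polynomial_function_nth: "polynomial_function (\<lambda>v. v $ i)"
  unfolding polynomial_function_def by (rule exI[of _ "Var i"]) simp

lemma polynomial_function_add:
  "polynomial_function f \<Longrightarrow> polynomial_function g \<Longrightarrow> polynomial_function (\<lambda>v. f v + g v)"
  unfolding polynomial_function_def by (metis poly_value.hom_add)

lemma polynomial_function_diff:
  "polynomial_function f \<Longrightarrow> polynomial_function g \<Longrightarrow> polynomial_function (\<lambda>v. f v - g v)"
  unfolding polynomial_function_def by (metis poly_value.hom_diff)

lemma polynomial_function_mult:
  "polynomial_function f \<Longrightarrow> polynomial_function g \<Longrightarrow> polynomial_function (\<lambda>v. f v * g v)"
  unfolding polynomial_function_def by (metis poly_value.hom_mult)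

lemma polynomial_function_power:
  "polynomial_function f \<Longrightarrow> polynomial_function (\<lambda>v. f v ^ n)"
  unfolding polynomial_function_def by (metis poly_value.hom_power)

lemma polynomial_function_divide: "polynomial_function f \<Longrightarrow> polynomial_function (\<lambda>v. f v / c)"
  using polynomial_function_mult[OF _ polynomial_function_const, of f "inverse c"]
  by (simp add: divide_inverse)

lemma polynomial_function_comp:
  fixes f :: "complex ^ 'n::finite \<Rightarrow> complex ^ 'n"
  assumes "\<And>i. polynomial_function (\<lambda>v. f v $ i)"
  shows "polynomial_function (\<lambda>v. poly_value F (f v))"
proof -
  obtain P where P: "\<And>i v. poly_value (P i) v = f v $ i"
    using assms unfolding polynomial_function_def by metis
  have "tuple_value P v = f v" for v by (simp add: vec_eq_iff P)
  then have "poly_value (insertion Const P F) v = poly_value F (f v)" for v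
    by (simp add: poly_value_insertion)
  then show ?thesis unfolding polynomial_function_def by blast
qed

lemmas polynomial_function_intros = polynomial_function_const polynomial_function_nth
  polynomial_function_add polynomial_function_diff polynomial_function_mult
  polynomial_function_power polynomial_function_divide polynomial_function_comp

text \<open>The de Jonquieres construction computes with functions on vectors; this yields the forms
  that \<open>form_map\<close> requires, with the degree read off from the scaling
  behaviour.\<close>

lemma polynomial_function_form:
  fixes f :: "complex ^ 4 \<Rightarrow> complex"
  assumes "polynomial_function f" "\<And>c v. c \<noteq> 0 \<Longrightarrow> f (c *s v) = c ^ e * f v"
  obtains P where "homogeneous e P" "\<And>v. poly_value P v = f v"
  using assms homogeneousI_scale[of _ e] unfolding polynomial_function_def by metis

section \<open>Choice of the centre of projection and of the parameter\<close>

lemma nonzero_form_zero_off_coordinate: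
  fixes F :: "4 cpoly"
  assumes "homogeneous d F" "d > 0"
  obtains p where "p \<noteq> 0" "p $ k = 0" "poly_value F p = 0"
proof -
  \<comment> \<open>The line through these two coordinate points lies in the hyperplane where
    coordinate \<open>k\<close> is 0.\<close>
  obtain a b :: 4 where ab: "a \<noteq> b" "a \<noteq> k" "b \<noteq> k"
    using numeral_4_distinct exhaust_4[of k] by metis
  obtain p where p: "poly_value F p = 0"
    "p = axis b 1 \<or> (\<exists>z. p = axis a 1 + z *s axis b 1)"
    using form_zero_on_line[OF assms, of "axis b 1" "axis a 1"] by metis
  have "p $ b = 1 \<or> p $ a = 1"
    using p(2) ab by (auto simp: axis_def)
  then have "p \<noteq> 0" by auto
  moreover have "p $ k = 0"
    using p(2) ab by (auto simp: axis_def)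
  ultimately show ?thesis using p(1) that by blast
qed

text \<open>The two conditions will say that the denominator and the determinant are nonzero at the
  prescribed point; each excludes finitely many \<open>t\<close>.\<close>

lemma quadratic_parameter:
  obtains t :: complex where "u + t \<noteq> 0" "t\<^sup>2 + t * b + e \<noteq> 0"
proof -
  have "[:u, 1:] * [:e, b, 1:] \<noteq> 0" by simp
  then obtain t where "poly ([:u, 1:] * [:e, b, 1:]) t \<noteq> 0"
    using poly_all_0_iff_0 by blast
  then have "poly [:u, 1:] t \<noteq> 0" "poly [:e, b, 1:] t \<noteq> 0"
    unfolding poly_mult by simp_all
  then show ?thesis by (intro that[of t]) (auto simp: power2_eq_square algebra_simps)
qed

text \<open>The coefficients of z and z^2 are homogeneous of degrees d - 1 and d - 2. Powers of
  \<open>c\<close> stand on the left so that no exponent is negative when \<open>d\<close> is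
  1.\<close>

lemma form_pencil_scale:
  assumes F: "homogeneous d F" "d \<le> 3" and p: "poly_value F p = 0" and c: "c \<noteq> 0"
  shows "c * ((poly_value F (c *s x + p) - poly_value F (c *s x - p)) / 2)
      = c ^ d * ((poly_value F (x + p) - poly_value F (x - p)) / 2)" (is ?b)
    and "c\<^sup>2 * ((poly_value F (c *s x + p) + poly_value F (c *s x - p) - 2 * poly_value F (c *s x)) / 2)
      = c ^ d * ((poly_value F (x + p) + poly_value F (x - p) - 2 * poly_value F x) / 2)" (is ?a)
proof -
  define B where "B = (poly_value F (x + p) - poly_value F (x - p)) / 2"
  define A where "A = (poly_value F (x + p) + poly_value F (x - p) - 2 * poly_value F x) / 2"
  have line: "poly_value F (c *s x + t *s p) = c ^ d * (poly_value F x + B * (t / c) + A * (t / c)\<^sup>2)" for t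
  proof -
    have "c *s x + t *s p = c *s (x + (t / c) *s p)"
      using c by (simp add: vec_eq_iff algebra_simps)
    then show ?thesis
      unfolding A_def B_def by (simp only: poly_value_scale[OF F(1)] form_expansion[OF F p])
  qed
  have eqs: "poly_value F (c *s x + p) = c ^ d * (poly_value F x + B / c + A / c\<^sup>2)"
    "poly_value F (c *s x - p) = c ^ d * (poly_value F x - B / c + A / c\<^sup>2)"
    "poly_value F (c *s x) = c ^ d * poly_value F x"
    using line[of 1] line[of "-1"] by (simp_all add: power_divide poly_value_scale[OF F(1)])
  have combine: "(e * (X + b + a) - e * (X - b + a)) / 2 = e * b"
    "(e * (X + b + a) + e * (X - b + a) - 2 * (e * X)) / 2 = e * a" for e X a b :: complex
    by (simp_all add: algebra_simps)
  show ?b ?a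
    unfolding B_def[symmetric] A_def[symmetric] eqs combine using c by simp_all
qed

lemma map_fixing_surface_pointwise:
  fixes F :: "4 cpoly"
  assumes F: "homogeneous d F" "F \<noteq> 0" and d: "0 < d" "d \<le> 3" and q0: "q0 \<in> zeros F"
  obtains f g where "inverse_isomorphisms f g" "f q0 = Some q0"
    and "\<And>q. q \<in> zeros F \<Longrightarrow> q \<in> dom f \<Longrightarrow> f q = Some q"
    and "\<And>U. openin zariski U \<Longrightarrow> U \<noteq> {} \<Longrightarrow> U \<subseteq> dom f \<Longrightarrow> \<exists>q\<in>U. f q \<noteq> Some q"
proof -
  obtain n where n: "d = Suc n" using d(1) by (cases d) auto
  obtain w where w: "w \<noteq> 0" "q0 = point w" by (rule point_cases)
  \<comment> \<open>The centre \<open>p\<close> will be a point of the surface with coordinate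
    \<open>j\<close> equal to 0. So it differs from \<open>q0\<close>, and projection from
    \<open>p\<close> preserves coordinate \<open>j\<close>.\<close>
  obtain j where j: "w $ j \<noteq> 0" using w(1) by (auto simp: vec_eq_iff)
  obtain r where r: "r \<noteq> 0" "r $ j = 0" "poly_value F r = 0"
    using nonzero_form_zero_off_coordinate[OF F(1) d(1)] .
  obtain k where k: "r $ k \<noteq> 0" using r(1) by (auto simp: vec_eq_iff)
  define p where "p = (1 / r $ k) *s r"
  have p: "p $ k = 1" "p $ j = 0" "poly_value F p = 0"
    using k r by (simp_all add: p_def poly_value_scale[OF F(1)])
  define B where "B x = (poly_value F (x + p) - poly_value F (x - p)) / 2" for x
  define A where "A x = (poly_value F (x + p) + poly_value F (x - p) - 2 * poly_value F x) / 2" for x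
  define x0 where "x0 = w - (w $ k) *s p"
  have x0_j: "x0 $ j = w $ j" by (simp add: x0_def p(2))
  obtain t where t: "A x0 * w $ k + B x0 + t \<noteq> 0" "t\<^sup>2 + t * B x0 + A x0 * poly_value F x0 \<noteq> 0"
    by (rule quadratic_parameter)
  \<comment> \<open>A form of degree d - 1 with value \<open>t\<close> at \<open>x0\<close>, the
    base point of the line through \<open>q0\<close>; it exists because coordinate \<open>j\<close>
    of \<open>x0\<close> is nonzero.\<close>
  define \<alpha> where "\<alpha> x = t / (w $ j) ^ n * (x $ j) ^ n" for x :: "complex ^ 4"
  have \<alpha>_x0: "\<alpha> x0 = t" using j by (simp add: \<alpha>_def x0_j)
  interpret de_jonquieres "poly_value F" A B \<alpha> p k d
  proof
    show "poly_value F (x + z *s p) = poly_value F x + B x * z + A x * z\<^sup>2" for x z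
      unfolding A_def B_def by (rule form_expansion[OF F(1) d(2) p(3)])
    show "poly_value F (c *s x) = c ^ d * poly_value F x" for c x
      by (rule poly_value_scale[OF F(1)])
    show "c * B (c *s x) = c ^ d * B x" "c\<^sup>2 * A (c *s x) = c ^ d * A x" if "c \<noteq> 0" for c x
      unfolding A_def B_def by (rule form_pencil_scale[OF F(1) d(2) p(3) that])+
    show "c * \<alpha> (c *s x) = c ^ d * \<alpha> x" for c x
      by (simp add: \<alpha>_def n power_mult_distrib)
  qed (rule p(1))
  have pf_base: "polynomial_function (\<lambda>v. base v $ i)" for i
    unfolding base_def by (simp add: polynomial_function_intros)
  have pf: "polynomial_function (\<lambda>v. A (base v))" "polynomial_function (\<lambda>v. B (base v))"
    "polynomial_function (\<lambda>v. \<alpha> (base v))" "polynomial_function (\<lambda>v. poly_value F (base v))"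
    unfolding A_def B_def \<alpha>_def
    by (intro polynomial_function_intros pf_base; simp add: polynomial_function_intros pf_base)+
  have s_scale': "s (c *s v) = c ^ n * s v" "s' (c *s v) = c ^ n * s' v"
    "\<Delta> (c *s v) = c ^ (2 * n) * \<Delta> v" if "c \<noteq> 0" for c v
    using s_scale[OF that, of v] s'_scale[OF that, of v] \<Delta>_scale[OF that, of v] that
    by (simp_all add: n power2_eq_square mult_2 power_add)
  have "polynomial_function s"
    unfolding s_def by (intro polynomial_function_intros pf)
  then obtain S where S: "homogeneous n S" "\<And>v. poly_value S v = s v"
    using polynomial_function_form s_scale'(1) by metis
  have "polynomial_function s'"
    unfolding s'_def by (intro polynomial_function_intros pf)
  then obtain S' where S': "homogeneous n S'" "\<And>v. poly_value S' v = s' v"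
    using polynomial_function_form s_scale'(2) by metis
  have "polynomial_function \<Delta>"
    unfolding \<Delta>_def by (intro polynomial_function_intros pf)
  then obtain D where D: "homogeneous (2 * n) D" "\<And>v. poly_value D v = \<Delta> v"
    using polynomial_function_form s_scale'(3) by metis
  define G where "G i = S * Var i - F * Const (p $ i)" for i
  define G' where "G' i = S' * Var i + F * Const (p $ i)" for i
  have G: "homogeneous d (G i)" "homogeneous d (G' i)" for i
    unfolding G_def G'_def
    using homogeneous_mult[OF S(1) homogeneous_Var, of i] homogeneous_mult[OF S'(1) homogeneous_Var, of i]
      homogeneous_mult[OF F(1) homogeneous_Const, of "p $ i"]
    by (auto intro!: homogeneous_add homogeneous_diff simp: n)
  have G_val: "tuple_value G v = jmap v" "tuple_value G' v = jinv v" for v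
    by (simp_all add: vec_eq_iff G_def G'_def jmap_def jinv_def S S' poly_value.hom_diff
        poly_value.hom_add poly_value.hom_mult)
  \<comment> \<open>Denominator and determinant together: where both are nonzero, the map is defined
    and its image lies where the inverse is defined.\<close>
  define K where "K = S * D"
  define K' where "K' = S' * D"
  have K: "homogeneous (n + 2 * n) K" "homogeneous (n + 2 * n) K'"
    unfolding K_def K'_def by (intro homogeneous_mult S S' D)+
  have K_val: "poly_value K v \<noteq> 0 \<longleftrightarrow> s v \<noteq> 0 \<and> \<Delta> v \<noteq> 0" "poly_value K' v \<noteq> 0 \<longleftrightarrow> s' v \<noteq> 0 \<and> \<Delta> v \<noteq> 0" for v
    by (simp_all add: K_def K'_def S S' D poly_value.hom_mult)
  have zero: "jmap 0 = 0" "jinv 0 = 0"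
    using poly_value_scale[OF F(1), of 0 0] by (simp_all add: jmap_def jinv_def n)
  have base_w: "base w = x0" by (simp add: base_def x0_def)
  have Kw: "poly_value K w \<noteq> 0"
    using t unfolding K_val s_def \<Delta>_def base_w \<alpha>_x0 by (simp add: ac_simps)
  have there: "jmap v \<noteq> 0 \<and> poly_value K' (jmap v) \<noteq> 0 \<and> (\<exists>c. c \<noteq> 0 \<and> jinv (jmap v) = c *s v)"
    if "v \<noteq> 0" "poly_value K v \<noteq> 0" for v
  proof -
    from that have v: "s v \<noteq> 0" "\<Delta> v \<noteq> 0" by (simp_all add: K_val)
    note reg = jmap_regular[OF v]
    have "jinv (jmap v) = (s' (jmap v) * s v) *s v" "s' (jmap v) * s v \<noteq> 0"
      using jinv_jmap[OF v(1)] reg v by simp_all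
    moreover from this have "jmap v \<noteq> 0" using zero that(1) by auto
    ultimately show ?thesis
      using reg by (intro conjI exI[of _ "s' (jmap v) * s v"]) (simp_all add: K_val)
  qed
  have there': "jinv v \<noteq> 0 \<and> poly_value K (jinv v) \<noteq> 0 \<and> (\<exists>c. c \<noteq> 0 \<and> jmap (jinv v) = c *s v)"
    if "v \<noteq> 0" "poly_value K' v \<noteq> 0" for v
  proof -
    from that have v: "s' v \<noteq> 0" "\<Delta> v \<noteq> 0" by (simp_all add: K_val)
    note reg = jinv_regular[OF v]
    have "jmap (jinv v) = (s (jinv v) * s' v) *s v" "s (jinv v) * s' v \<noteq> 0"
      using jmap_jinv[OF v(1)] reg v by simp_all
    moreover from this have "jinv v \<noteq> 0" using zero that(1) by auto
    ultimately show ?thesis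
      using reg by (intro conjI exI[of _ "s (jinv v) * s' v"]) (simp_all add: K_val)
  qed
  have q0K: "q0 \<notin> zeros K" using Kw point_in_zeros_iff[OF K(1) w(1)] w(2) by simp
  have iso: "inverse_isomorphisms (form_map K G) (form_map K' G')"
    by (rule inverse_isomorphisms_form_map[OF K _ G])
      (use q0K in blast, unfold G_val, use there in blast, use there' in blast)
  have val: "form_map K G (point v) = Some (point (jmap v))" "jmap v \<noteq> 0"
    if "v \<noteq> 0" "poly_value K v \<noteq> 0" for v
    using form_map_point[OF K(1) G(1) that] there[OF that] by (simp_all add: G_val)
  have fixed: "form_map K G q = Some q" if q: "q \<in> zeros F" "q \<in> dom (form_map K G)" for q
  proof -
    obtain v where v: "v \<noteq> 0" "q = point v" by (rule point_cases)
    have Kv: "poly_value K v \<noteq> 0"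
      using q(2) point_in_zeros_iff[OF K(1) v(1)] v(2) by (simp add: dom_form_map)
    have "poly_value F v = 0" using q(1) point_in_zeros_iff[OF F(1) v(1)] v(2) by simp
    then have "jmap v = s v *s v" by (simp add: jmap_def)
    moreover have "s v \<noteq> 0" using Kv K_val by blast
    ultimately show ?thesis using val(1)[OF v(1) Kv] v by (simp add: point_scale)
  qed
  have moves: "\<exists>q\<in>U. form_map K G q \<noteq> Some q"
    if U: "openin zariski U" "U \<noteq> {}" "U \<subseteq> dom (form_map K G)" for U
  proof (rule ccontr)
    assume all: "\<not> ?thesis"
    \<comment> \<open>Since \<open>p\<close> has coordinates 0 and 1 at \<open>j\<close> and
      \<open>k\<close>, this product is up to sign the minor of \<open>v\<close> and
      \<open>jmap v\<close> in these rows, which vanishes wherever the point is fixed.\<close>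
    have "F * Var j = 0"
    proof (rule vanishing_on_open[OF U(1,2)])
      fix v :: "complex ^ 4" assume v: "v \<noteq> 0" "point v \<in> U"
      have Kv: "poly_value K v \<noteq> 0"
        using v(2) U(3) point_in_zeros_iff[OF K(1) v(1)] by (auto simp: dom_form_map)
      have "point v = point (jmap v)"
        using all val(1)[OF v(1) Kv] v(2) by auto
      from minors_vanish[OF v(1) val(2)[OF v(1) Kv] this, of j k]
      show "poly_value (F * Var j) v = 0"
        by (simp add: jmap_def p poly_value.hom_mult algebra_simps)
    qed
    then have "Var j = 0" using F(2) by simp
    then show False using j poly_value_Var[of j w] poly_value.hom_zero[of w] by simp
  qed
  have "form_map K G q0 = Some q0"
    by (rule fixed[OF q0]) (use q0K in \<open>simp add: dom_form_map\<close>)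
  with iso fixed moves that show ?thesis by blast
qed

section \<open>Automorphisms of projective space\<close>

text \<open>One local representation is freed of its common factor. Every other one is then a
  multiple of the reduced tuple, so the reduced tuple has no zero and represents the map
  everywhere.\<close>

lemma global_forms:
  fixes w :: "4 proj \<rightharpoonup> 4 proj"
  assumes w: "partial_morphism w" "dom w = UNIV"
  obtains A e where "\<And>i. homogeneous e (A i)"
    and "\<And>v. v \<noteq> 0 \<Longrightarrow> tuple_value A v \<noteq> 0 \<and> w (point v) = Some (point (tuple_value A v))"
proof -
  have dom: "p \<in> dom w" for p by (simp add: w(2))
  obtain U G d where G: "point 1 \<in> U" "represents G d U w"
    using partial_morphism_representation[OF w(1) dom] .
  have "(1 :: complex ^ 4) \<noteq> 0" by (simp add: vec_eq_iff)
  then have "tuple_value G 1 \<noteq> 0" using G by (auto simp: represents_def)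
  then obtain i where "poly_value (G i) 1 \<noteq> 0" by (auto simp: vec_eq_iff)
  then have Gi: "G i \<noteq> 0" by (auto simp: poly_value.hom_zero)
  have G_hom: "homogeneous d (G i)" for i using G(2) by (simp add: represents_def)
  obtain g B e where B: "\<And>i. G i = g * B i" "\<And>i. homogeneous e (B i)" "g \<noteq> 0"
    and prim: "\<And>C. (\<And>i j. B i * C j = B j * C i) \<Longrightarrow> \<exists>h. \<forall>i. C i = h * B i"
    by (rule common_factor[of d G i, OF G_hom Gi]) blast
  have "tuple_value B v \<noteq> 0 \<and> w (point v) = Some (point (tuple_value B v))" if v: "v \<noteq> 0" for v
  proof -
    obtain V C k where C: "point v \<in> V" "represents C k V w"
      using partial_morphism_representation[OF w(1) dom] .
    have "B i * C j = B j * C i" for i j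
    proof -
      have "G i * C j = G j * C i"
        by (rule representations_minors[OF G(2) _ C(2) _ openin_zariski_UNIV]) (use G(1) C(1) in auto)
      then have "g * (B i * C j) = g * (B j * C i)" by (simp only: B(1) mult.assoc)
      then show ?thesis using B(3) by simp
    qed
    then obtain h where h: "\<And>i. C i = h * B i" using prim[of C] by blast
    have C_val: "tuple_value C v \<noteq> 0" "w (point v) = Some (point (tuple_value C v))"
      using C v by (auto simp: represents_def)
    have eq: "tuple_value C v = poly_value h v *s tuple_value B v"
      by (simp add: vec_eq_iff h poly_value.hom_mult)
    then have "poly_value h v \<noteq> 0" "tuple_value B v \<noteq> 0" using C_val(1) by auto
    then show ?thesis using C_val(2) unfolding eq by (simp add: point_scale)
  qed
  with B(2) that show ?thesis by blast
qed

text \<open>On the line x + z y the first coordinate \<open>q\<close> has no zero, hence is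
  constant, and the second coordinate is z times \<open>q\<close>, of degree 1.\<close>

lemma degree_one_if_fixes_all_points:
  fixes Q :: "4 \<Rightarrow> 4 cpoly"
  assumes Q: "\<And>i. homogeneous m (Q i)"
    and fixed: "\<And>v. v \<noteq> 0 \<Longrightarrow> tuple_value Q v \<noteq> 0 \<and> point (tuple_value Q v) = point v"
  shows "m = 1"
proof -
  let ?x = "axis 1 1 :: complex ^ 4" and ?y = "axis 2 1 :: complex ^ 4"
  have coords: "?x $ 1 = 1" "?x $ 2 = 0" "?y $ 1 = 0" "?y $ 2 = 1"
    by (simp_all add: axis_def)
  have parallel: "\<exists>c. c \<noteq> 0 \<and> tuple_value Q v = c *s v" if "v \<noteq> 0" for v
    using fixed[OF that] that point_eq_iff[of v "tuple_value Q v"] by auto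
  obtain q where q: "degree q \<le> m" "coeff q m = poly_value (Q 1) ?y"
    "\<And>z. poly q z = poly_value (Q 1) (?x + z *s ?y)"
    using form_on_line[OF Q[of 1]] by metis
  obtain r where r: "degree r \<le> m" "coeff r m = poly_value (Q 2) ?y"
    "\<And>z. poly r z = poly_value (Q 2) (?x + z *s ?y)"
    using form_on_line[OF Q[of 2]] by metis
  have line: "poly q z \<noteq> 0 \<and> poly r z = z * poly q z" for z
  proof -
    have "(?x + z *s ?y) $ 1 = 1" by (simp add: coords)
    then have "?x + z *s ?y \<noteq> 0" by (metis zero_index zero_neq_one)
    then obtain c where c: "c \<noteq> 0" "tuple_value Q (?x + z *s ?y) = c *s (?x + z *s ?y)"
      using parallel by blast
    have "poly q z = c" "poly r z = c * z"
      using arg_cong[OF c(2), of "\<lambda>u. u $ 1"] arg_cong[OF c(2), of "\<lambda>u. u $ 2"]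
      by (simp_all add: q(3) r(3) coords)
    with c(1) show ?thesis by simp
  qed
  then have "constant (poly q)"
    using fundamental_theorem_of_algebra by blast
  then obtain c where c: "q = [:c:]" by (metis constant_degree degree_eq_zeroE)
  have "poly r = poly [:0, c:]" using line by (auto simp: c)
  then have r_eq: "r = [:0, c:]" by (simp only: poly_eq_poly_eq_iff)
  have c0: "c \<noteq> 0" using line[of 0] by (simp add: c)
  \<comment> \<open>The point at infinity of the line shows that the second coordinate attains the
    full degree \<open>m\<close>.\<close>
  have "?y \<noteq> 0" by (metis coords(4) zero_index zero_neq_one)
  then obtain b where b: "b \<noteq> 0" "tuple_value Q ?y = b *s ?y" using parallel by blast
  have "poly_value (Q 2) ?y = b"
    using arg_cong[OF b(2), of "\<lambda>u. u $ 2"] by (simp add: coords)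
  then have "coeff r m \<noteq> 0" using r(2) b(1) by simp
  then have "degree r = m" using r(1) le_degree[of r m] by simp
  then show ?thesis using r_eq c0 by simp
qed

text \<open>Degrees multiply under composition, and the composite with the inverse fixes every
  point, so the product of the two degrees is 1.\<close>

lemma isomorphism_linear:
  fixes w :: "4 proj \<rightharpoonup> 4 proj"
  assumes "isomorphism w"
  obtains A where "\<And>i. homogeneous 1 (A i)"
    and "\<And>v. v \<noteq> 0 \<Longrightarrow> tuple_value A v \<noteq> 0 \<and> w (point v) = Some (point (tuple_value A v))"
proof -
  obtain g where w: "dom w = UNIV" "dom g = UNIV" "inverse_isomorphisms w g"
    using assms by (auto simp: isomorphism_def)
  note pm = inverse_isomorphismsD(1,2)[OF w(3)]
  obtain A e where A: "\<And>i. homogeneous e (A i)"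
    "\<And>v. v \<noteq> 0 \<Longrightarrow> tuple_value A v \<noteq> 0 \<and> w (point v) = Some (point (tuple_value A v))"
    using global_forms[OF pm(1) w(1)] by metis
  obtain A' e' where A': "\<And>i. homogeneous e' (A' i)"
    "\<And>v. v \<noteq> 0 \<Longrightarrow> tuple_value A' v \<noteq> 0 \<and> g (point v) = Some (point (tuple_value A' v))"
    using global_forms[OF pm(2) w(2)] by metis
  have "e' * e = 1"
  proof (rule degree_one_if_fixes_all_points)
    show "homogeneous (e' * e) (insertion Const A (A' i))" for i
      by (rule homogeneous_insertion[OF A'(1) A(1)])
    fix v :: "complex ^ 4" assume v: "v \<noteq> 0"
    have eq: "tuple_value (\<lambda>i. insertion Const A (A' i)) v = tuple_value A' (tuple_value A v)"
      by (simp add: vec_eq_iff poly_value_insertion)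
    have Av: "tuple_value A v \<noteq> 0" "w (point v) = Some (point (tuple_value A v))"
      using A(2)[OF v] by simp_all
    have "g (point (tuple_value A v)) = Some (point v)"
      using Av(2) inverse_isomorphismsD(3)[OF w(3)] by blast
    then show "tuple_value (\<lambda>i. insertion Const A (A' i)) v \<noteq> 0 \<and>
        point (tuple_value (\<lambda>i. insertion Const A (A' i)) v) = point v"
      unfolding eq using A'(2)[OF Av(1)] by simp
  qed
  then have "e = 1" by simp
  with A that show ?thesis by blast
qed


section \<open>Maps fixing a hypersurface pointwise\<close>

text \<open>The hypersurface is irreducible as a space: each of its nonempty open parts is
  dense.\<close>

lemma hypersurface_opens_meet:
  fixes F :: "4 cpoly"
  assumes F: "irreducible F" "homogeneous d F"
    and U: "openin zariski U" "zeros F \<inter> U \<noteq> {}" and V: "openin zariski V" "zeros F \<inter> V \<noteq> {}"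
  shows "zeros F \<inter> (U \<inter> V) \<noteq> {}"
proof -
  obtain p where p: "p \<in> zeros F" "p \<in> V" using V(2) by blast
  have "p \<in> zariski closure_of (zeros F \<inter> U)"
    using closure_of_open_part[OF F U] p(1) by simp
  then show ?thesis using p(2) V(1) by (auto simp: in_closure_of)
qed

text \<open>The minors of a local representation against the coordinates vanish on an open part of
  the hypersurface, so \<open>F\<close> divides them. This is needed because passing to the maximal
  representative enlarges the domain.\<close>

lemma fixes_hypersurface:
  fixes F :: "4 cpoly"
  assumes F: "irreducible F" "homogeneous d F" and w: "partial_morphism w"
    and N: "openin zariski N" "zeros F \<inter> N \<noteq> {}" "\<And>p. p \<in> zeros F \<inter> N \<Longrightarrow> w p = Some p"
    and p: "p \<in> zeros F" "p \<in> dom w"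
  shows "w p = Some p"
proof -
  obtain U G e where G: "p \<in> U" "represents G e U w"
    using partial_morphism_representation[OF w p(2)] .
  have U: "openin zariski U" "zeros F \<inter> U \<noteq> {}" using G p(1) by (auto simp: represents_def)
  obtain v where v: "v \<noteq> 0" "p = point v" by (rule point_cases)
  have Fv: "poly_value F v = 0" using p(1) v point_in_zeros_iff[OF F(2) v(1)] by simp
  have "F dvd G i * Var j - G j * Var i" for i j
  proof (rule irreducible_dvd_if_vanishing_on_open[OF F])
    show "openin zariski (U \<inter> N)" using U(1) N(1) by blast
    show "zeros F \<inter> (U \<inter> N) \<noteq> {}" by (rule hypersurface_opens_meet[OF F U N(1,2)])
    fix u :: "complex ^ 4" assume u: "u \<noteq> 0" "point u \<in> zeros F \<inter> (U \<inter> N)"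
    then have Gu: "tuple_value G u \<noteq> 0" "w (point u) = Some (point (tuple_value G u))"
      using G(2) by (auto simp: represents_def)
    have "point (tuple_value G u) = point u"
      using Gu(2) N(3)[of "point u"] u(2) by simp
    from minors_vanish[OF Gu(1) u(1) this, of i j]
    show "poly_value (G i * Var j - G j * Var i) u = 0"
      by (simp add: poly_value.hom_diff poly_value.hom_mult)
  qed
  then have "poly_value (G i * Var j - G j * Var i) v = 0" for i j
    using Fv by (metis dvd_def mult_zero_left poly_value.hom_mult)
  then have minors: "tuple_value G v $ i * v $ j = tuple_value G v $ j * v $ i" for i j
    by (simp add: poly_value.hom_diff poly_value.hom_mult)
  have Gv: "tuple_value G v \<noteq> 0" "w p = Some (point (tuple_value G v))"
    using G v by (auto simp: represents_def)
  have "point (tuple_value G v) = p"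
    unfolding v(2) by (rule point_eqI[OF Gv(1) v(1) minors])
  with Gv(2) show ?thesis by simp
qed

lemma isomorphism_fixing_hypersurface:
  fixes F :: "4 cpoly"
  assumes F: "irreducible F" "homogeneous d F" "d > 2" and w: "isomorphism w"
    and fixed: "\<And>p. p \<in> zeros F \<Longrightarrow> w p = Some p"
  shows "w p = Some p"
proof -
  obtain A where A: "\<And>i. homogeneous 1 (A i)"
    "\<And>v. v \<noteq> 0 \<Longrightarrow> tuple_value A v \<noteq> 0 \<and> w (point v) = Some (point (tuple_value A v))"
    using isomorphism_linear[OF w] by metis
  have minor: "A i * Var j - A j * Var i = 0" for i j
  proof (rule ccontr)
    assume nz: "A i * Var j - A j * Var i \<noteq> 0"
    have "homogeneous 2 (A i * Var j - A j * Var i)"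
      using homogeneous_mult[OF A(1) homogeneous_Var, of i j] homogeneous_mult[OF A(1) homogeneous_Var, of j i]
        homogeneous_diff by (simp add: numeral_2_eq_2)
    moreover have "F dvd A i * Var j - A j * Var i"
    proof (rule irreducible_dvd_if_vanishing[OF F(1)])
      fix v assume v: "poly_value F v = 0"
      show "poly_value (A i * Var j - A j * Var i) v = 0"
      proof (cases "v = 0")
        case False
        then have "w (point v) = Some (point v)"
          using fixed v point_in_zeros_iff[OF F(2)] by blast
        then have "point (tuple_value A v) = point v" using A(2)[OF False] by simp
        from minors_vanish[OF _ False this, of i j] show ?thesis
          using A(2)[OF False] by (simp add: poly_value.hom_diff poly_value.hom_mult)
      qed (simp add: poly_value.hom_diff poly_value.hom_mult)
    qed
    ultimately have "d \<le> 2" using homogeneous_dvd_degree_le[OF F(2) _ _ nz] by blast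
    with F(3) show False by simp
  qed
  obtain v where v: "v \<noteq> 0" "p = point v" by (rule point_cases)
  have "tuple_value A v $ i * v $ j = tuple_value A v $ j * v $ i" for i j
    using arg_cong[OF minor[of i j], of "\<lambda>F. poly_value F v"]
    by (simp add: poly_value.hom_diff poly_value.hom_mult poly_value.hom_zero)
  then have "point (tuple_value A v) = point v"
    using A(2)[OF v(1)] v(1) by (intro point_eqI) simp_all
  then show ?thesis using A(2)[OF v(1)] v by simp
qed

text \<open>A form of degree 0 is a constant, thus zero or a unit. Positivity is what provides a
  zero to project from.\<close>

lemma irreducible_form_degree_pos:
  assumes "irreducible F" "homogeneous d F"
  shows "d > 0"
proof (rule ccontr)
  assume "\<not> d > 0"
  then have deg: "(\<Sum>i\<in>UNIV. Poly_Mapping.lookup m i) = 0" if "m \<in> Poly_Mapping.keys F" for m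
    using assms(2) that by (auto simp: homogeneous_def)
  have "m = 0" if "m \<in> Poly_Mapping.keys F" for m
    by (rule poly_mapping_eqI) (use deg[OF that] in simp)
  then have "F = Const (Poly_Mapping.lookup F 0)"
    unfolding Const_def
    by (intro poly_mapping_eqI) (auto simp: lookup_single when_def in_keys_iff)
  then obtain c where c: "F = Const c" by blast
  have "c \<noteq> 0" using assms(1) c Const.hom_zero by (auto simp: irreducible_def)
  then have "F * Const (inverse c) = 1"
    unfolding c by (simp add: Const.hom_mult[symmetric] Const.hom_one)
  then show False using assms(1) by (metis dvd_triv_left irreducible_not_unit)
qed

section \<open>Conjugation back to the quartic\<close>

theorem corollary2p13:
  fixes S :: "4 proj set"
  assumes "irreducible_hypersurface 4 S"
    and "min_cremona_degree S \<noteq> 4"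
  shows "nontrivial_stabilizer S"
proof -
  obtain F where F: "homogeneous 4 F" "irreducible F" and S: "S = zeros F"
    using assms(1) by (auto simp: irreducible_hypersurface_def)
  obtain r where "r \<noteq> 0" "poly_value F r = 0"
    using nonzero_form_zero_off_coordinate[OF F(1)] by auto
  then have "point r \<in> S" unfolding S zeros_def by blast
  then have self: "cremona_equivalent S S"
    using cremona_equivalent_refl[OF F(1)] S by blast
  let ?P = "\<lambda>d. \<exists>Y. irreducible_hypersurface d Y \<and> cremona_equivalent S Y"
  define d where "d = min_cremona_degree S"
  \<comment> \<open>Supplies a witness for \<open>LEAST\<close>, so the minimum is attained and is
    at most 4.\<close>
  have "?P 4" using assms(1) self by blast
  then have "?P d" "d \<le> 4"
    unfolding d_def min_cremona_degree_def by (rule LeastI, rule Least_le)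
  then obtain H \<phi> where H: "homogeneous d H" "irreducible H"
    and iso: "isomorphism_at_generic_point \<phi> S" and image: "proper_image \<phi> S = zeros H"
    by (auto simp: irreducible_hypersurface_def cremona_equivalent_def)
  have d: "0 < d" "d \<le> 3"
    using irreducible_form_degree_pos[OF H(2,1)] \<open>d \<le> 4\<close> assms(2) d_def by auto
  obtain U g where U: "openin zariski U" "U \<inter> S \<noteq> {}"
    and inv: "inverse_isomorphisms (\<phi> |` U) g" and U_dom: "U \<subseteq> dom \<phi>"
    using iso by (auto simp: isomorphism_at_generic_point_def)
  define \<psi> where "\<psi> = \<phi> |` U"
  note \<psi> = inv[folded \<psi>_def]
  have to_image: "q \<in> zeros H" if "p \<in> S" "\<psi> p = Some q" for p q
  proof -
    have "\<phi> p = Some q" using that(2) by (auto simp: \<psi>_def restrict_map_def split: if_splits)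
    then have "q \<in> zariski closure_of {q. \<exists>p\<in>S. \<phi> p = Some q}"
      using closure_of_subset[of "{q. \<exists>p\<in>S. \<phi> p = Some q}" zariski] that(1)
      by (auto simp: topspace_zariski)
    then show ?thesis using image by (simp add: proper_image_def)
  qed
  obtain p0 where p0: "p0 \<in> U" "p0 \<in> S" using U(2) by blast
  then obtain q0 where q0: "\<psi> p0 = Some q0" using U_dom by (auto simp: \<psi>_def)
  have H0: "H \<noteq> 0" using H(2) by auto
  obtain f f' where ff': "inverse_isomorphisms f f'" and f_q0: "f q0 = Some q0"
    and f_fixed: "\<And>q. q \<in> zeros H \<Longrightarrow> q \<in> dom f \<Longrightarrow> f q = Some q"
    and f_moves: "\<And>U. openin zariski U \<Longrightarrow> U \<noteq> {} \<Longrightarrow> U \<subseteq> dom f \<Longrightarrow> \<exists>q\<in>U. f q \<noteq> Some q"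
    using map_fixing_surface_pointwise[OF H(1) H0 d to_image[OF p0(2) q0]] by metis
  have g: "g q = Some p \<longleftrightarrow> \<psi> p = Some q" for p q
    using inverse_isomorphismsD(3)[OF \<psi>] by blast
  \<comment> \<open>The conjugate of \<open>f\<close>, as an isomorphism of open sets. As
    \<open>f\<close> fixes \<open>q0\<close>, the composite is defined at \<open>p0\<close>, so its
    domain meets \<open>S\<close>.\<close>
  define \<theta> where "\<theta> = g \<circ>\<^sub>m (f \<circ>\<^sub>m \<psi>)"
  have \<theta>_p0: "\<theta> p0 = Some p0" using q0 f_q0 g by (simp add: \<theta>_def map_comp_def)
  have "inverse_isomorphisms \<theta> ((g \<circ>\<^sub>m f') \<circ>\<^sub>m \<psi>)"
    unfolding \<theta>_def
  proof (intro inverse_isomorphisms_comp[OF _ inverse_isomorphisms_sym[OF \<psi>]]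
      inverse_isomorphisms_comp[OF \<psi> ff'])
    have "(f \<circ>\<^sub>m \<psi>) p0 = Some q0" using q0 f_q0 by (simp add: map_comp_def)
    then show "dom (f \<circ>\<^sub>m \<psi>) \<noteq> {}" by blast
    show "dom (g \<circ>\<^sub>m (f \<circ>\<^sub>m \<psi>)) \<noteq> {}" using \<theta>_p0 unfolding \<theta>_def by blast
  qed
  then obtain \<theta>' where \<theta>: "inverse_isomorphisms \<theta> \<theta>'" by blast
  have \<theta>_fixed: "\<theta> p = Some p" if p: "p \<in> S" "p \<in> dom \<theta>" for p
  proof -
    obtain q where q: "\<psi> p = Some q" "q \<in> dom f"
      using p(2) by (auto simp: \<theta>_def map_comp_Some_iff dom_def)
    have "f q = Some q" by (rule f_fixed[OF to_image[OF p(1) q(1)] q(2)])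
    then show ?thesis using q(1) g by (simp add: \<theta>_def map_comp_def)
  qed
  have \<theta>_open: "openin zariski (dom \<theta>)"
    using inverse_isomorphismsD(1)[OF \<theta>] by (rule partial_morphism_open)
  have meets: "zeros F \<inter> dom \<theta> \<noteq> {}" using p0(2) \<theta>_p0 S by blast
  obtain w where w: "birational w" "\<theta> \<subseteq>\<^sub>m w" using birational_extension[OF \<theta>] .
  have w_\<theta>: "w p = \<theta> p" if "p \<in> dom \<theta>" for p using w(2) that by (simp add: map_le_def)
  have dom_\<theta>: "dom \<theta> \<subseteq> dom w" by (rule map_le_implies_dom_le[OF w(2)])
  have pm: "partial_morphism w" using w(1) by (simp add: birational_def rational_map_def)
  have w_fixed: "w p = Some p" if "p \<in> S" "p \<in> dom w" for p
    by (rule fixes_hypersurface[OF F(2,1) pm \<theta>_open meets]) (use \<theta>_fixed w_\<theta> S that in auto)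
  have "isomorphism_at_generic_point w S"
    unfolding isomorphism_at_generic_point_def
  proof (intro exI conjI)
    show "openin zariski (dom \<theta>)" by (rule \<theta>_open)
    show "dom \<theta> \<subseteq> dom w" by (rule dom_\<theta>)
    show "dom \<theta> \<inter> S \<noteq> {}" using meets S by blast
    have "w |` dom \<theta> = \<theta>" using w_\<theta> by (auto simp: restrict_map_def fun_eq_iff domIff)
    then show "inverse_isomorphisms (w |` dom \<theta>) \<theta>'" using \<theta> by simp
  qed
  moreover have "proper_image w S = S"
  proof -
    \<comment> \<open>The points of \<open>S\<close> where \<open>w\<close> is defined are fixed;
      their closure is all of \<open>S\<close> by irreducibility.\<close>
    have "{q. \<exists>p\<in>S. w p = Some q} = zeros F \<inter> dom w"
      using w_fixed S by force
    moreover have "zeros F \<inter> dom w \<noteq> {}" using meets dom_\<theta> by blast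
    ultimately show ?thesis
      unfolding proper_image_def S using closure_of_open_part[OF F(2,1) partial_morphism_open[OF pm]] S by simp
  qed
  moreover have "\<not> isomorphism w"
  proof
    assume w_iso: "isomorphism w"
    then have dom_w: "dom w = UNIV" by (simp add: isomorphism_def)
    have identity: "w p = Some p" for p
      by (rule isomorphism_fixing_hypersurface[OF F(2,1) _ w_iso]) (use w_fixed dom_w S in auto)
    \<comment> \<open>On this set both \<open>q\<close> and its image under \<open>f\<close> can be
      pulled back by \<open>g\<close>. If \<open>w\<close> were the identity, both would have the
      same preimage, so \<open>f\<close> would fix a nonempty open set pointwise.\<close>
    let ?N = "dom (g \<circ>\<^sub>m f) \<inter> dom g"
    have "g q0 = Some p0" "(g \<circ>\<^sub>m f) q0 = Some p0" using f_q0 q0 g by (simp_all add: map_comp_def)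
    then have q0_N: "q0 \<in> ?N" by blast
    then have "partial_morphism (g \<circ>\<^sub>m f)"
      by (intro partial_morphism_comp[OF inverse_isomorphismsD(1)[OF ff'] inverse_isomorphismsD(2)[OF \<psi>]])
        blast
    note gf = this
    have "?N \<noteq> {}" using q0_N by blast
    moreover have "openin zariski ?N"
      by (intro openin_Int partial_morphism_open gf inverse_isomorphismsD(2)[OF \<psi>])
    moreover have "?N \<subseteq> dom f" by (auto simp: map_comp_Some_iff)
    ultimately obtain q where q: "q \<in> ?N" "f q \<noteq> Some q" using f_moves[of ?N] by blast
    then obtain r u v where r: "f q = Some r" "g r = Some u" "g q = Some v"
      by (auto simp: map_comp_Some_iff)
    then have "\<theta> v = Some u" using g by (auto simp: \<theta>_def map_comp_def)
    then have "u = v" using w_\<theta>[of v] identity[of v] by auto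
    then have "r = q" using r g by (metis option.inject)
    with q(2) r(1) show False by simp
  qed
  ultimately show ?thesis unfolding nontrivial_stabilizer_def using w(1) by blast
qed

end
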